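(* In the OQAM block model $\mathbf{y}=\boldsymbol{\Gamma}\mathbf{x}+\mathbf{v}$ described in the context, the average MMSE of the real-only equalizer (ROE) is less than, or equal to, that of the classical linear equalizer (LE): $$\mathrm{MMSE}_{\mathrm{av,ROE}}\le \mathrm{MMSE}_{\mathrm{av,LE}}.$$
   Context: Notation: $j$ is the imaginary unit; ${}^\top$, ${}^*$, ${}^\dagger$ denote transpose, entrywise complex conjugate, and conjugate transpose; $E$ is expectation; $\mathrm{tr}$ is trace. Signal model. Let $\nu\ge 1$ be an integer, and let vectors be indexed by $n=0,\dots,2\nu-1$. The real random vector $\mathbf{a}=[a(0),\dots,a(2\nu-1)]^\top$ has independent entries, each uniformly distributed on $\{\pm A,\pm 3A,\dots,\pm(N-1)A\}$, where $A>0$, $N\in\{2,4,8,\dots\}$, normalized so that the average symbol energy $\frac{2A^2}{N}\{1^2+3^2+\dots+(N-1)^2\}$ equals $1$. The transmitted OQAM vector $\mathbf{x}$ has entries $x(n)=a(n)$ for $n$ even and $x(n)=j\,a(n)$ for $n$ odd. Channel. $h(0),\dots,h(L)$ are the (deterministic, complex, not all zero) taps of a causal discrete-time channel, $h(k)=0$ for other $k$, and $\gamma(k)=\sum_{l} h(l+k)h^*(l)$. $\boldsymbol{\Gamma}$ is the $2\nu\times 2\nu$ Hermitian positive-definite Toeplitz matrix with $(m,n)$ entry $\gamma(m-n)$ (the channel autocorrelation matrix). The sampled matched-filter output is $\mathbf{y}=\boldsymbol{\Gamma}\mathbf{x}+\mathbf{v}$, where $\mathbf{v}$ is a zero-mean,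 circularly symmetric complex Gaussian noise vector independent of $\mathbf{x}$ with $E[\mathbf{v}\mathbf{v}^\dagger]=\sigma^2\boldsymbol{\Gamma}$ and $E[\mathbf{v}\mathbf{v}^\top]=0$, where $\sigma^2=2N_0\ge 0$. Matrices. $\mathbf{A}=\mathrm{diag}[\tfrac12,\tfrac{-j}{2},\tfrac12,\dots,\tfrac{-j}{2}]$ and $\mathbf{B}=\mathrm{diag}[1,-1,1,\dots,-1]$, both $2\nu\times 2\nu$ (the matrix $\mathbf{A}$ is unrelated to the scalar amplitude $A$). Thus $\mathbf{x}=2\mathbf{A}^\dagger\mathbf{a}$. LE. $\hat{\mathbf{x}}_{\mathrm{LE}}=[\boldsymbol{\Gamma}+\sigma^2\mathbf{I}]^{-1}\mathbf{y}$, and its average MMSE over all $2\nu$ symbols is $$\mathrm{MMSE}_{\mathrm{av,LE}}=\frac{1}{2\nu}\mathrm{tr}\,E\big[(\mathbf{x}-\hat{\mathbf{x}}_{\mathrm{LE}})(\mathbf{x}-\hat{\mathbf{x}}_{\mathrm{LE}})^\dagger\big]=\frac{\sigma^2}{2\nu}\mathrm{tr}\big\{[\boldsymbol{\Gamma}+\sigma^2\mathbf{I}]^{-1}\big\}.$$ ROE. Put $\mathbf{y}_a=\mathbf{A}(\mathbf{y}+\mathbf{B}\mathbf{y}^* )=\boldsymbol{\Gamma}_a\mathbf{a}+\mathbf{v}_a$, where $\mathbf{v}_a=\mathbf{A}(\mathbf{v}+\mathbf{B}\mathbf{v}^* )$ and $\boldsymbol{\Gamma}_a=2\mathbf{A}(\boldsymbol{\Gamma}+\mathbf{B}\boldsymbol{\Gamma}^\top\mathbf{B})\mathbf{A}^\dagger$.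 The ROE output is $\hat{\mathbf{a}}=[\boldsymbol{\Gamma}_a+\frac{\sigma^2}{2}\mathbf{I}]^{-1}\mathbf{y}_a$, and its average MMSE over all $2\nu$ symbols is $$\mathrm{MMSE}_{\mathrm{av,ROE}}=\frac{1}{2\nu}\mathrm{tr}\,E\big[(\mathbf{a}-\hat{\mathbf{a}})(\mathbf{a}-\hat{\mathbf{a}})^\dagger\big]=\frac{\sigma^2}{4\nu}\mathrm{tr}\Big\{\Big[\boldsymbol{\Gamma}_a+\tfrac{\sigma^2}{2}\mathbf{I}\Big]^{-1}\Big\}.$$ *)

theory Defs
  imports
    "HOL-Probability.Probability"
    "Jordan_Normal_Form.Gauss_Jordan_Elimination"
    "Jordan_Normal_Form.Schur_Decomposition"
begin

text \<open>
  Vectors indexed by \<open>0, \<dots>, n - 1\<close> are \<open>n \<times> 1\<close> matrices, so that products such as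
  \<open>v v\<dagger>\<close> and \<open>v v\<top>\<close> are matrix products. Random vectors are families \<open>nat \<Rightarrow> 'w \<Rightarrow> _\<close>
  of which only the entries below \<open>n\<close> matter. Many names (\<open>mat\<close>, \<open>trace\<close>, \dots) exist in both
  imported developments; all of them are meant for the matrices \<open>Matrix.mat\<close> with explicit
  dimensions.
\<close>

definition col_vec :: "nat \<Rightarrow> (nat \<Rightarrow> complex) \<Rightarrow> complex mat" where
  "col_vec n f = Matrix.mat n 1 (\<lambda>(i, j). f i)"

abbreviation mat_cnj :: "complex mat \<Rightarrow> complex mat" where
  "mat_cnj X \<equiv> map_mat cnj X"

definition mat_tr :: "complex mat \<Rightarrow> complex" where
  "mat_tr X = (\<Sum>i<dim_row X. X $$ (i, i))"

text \<open>Only applied to invertible matrices, where \<open>mat_inverse\<close> does not return \<open>None\<close>.\<close>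

definition minv :: "complex mat \<Rightarrow> complex mat" where
  "minv X = the (mat_inverse X)"

definition expect_mat :: "'w measure \<Rightarrow> nat \<Rightarrow> nat \<Rightarrow> ('w \<Rightarrow> complex mat) \<Rightarrow> complex mat" where
  "expect_mat M n m F = Matrix.mat n m (\<lambda>(i, j). \<integral>\<omega>. F \<omega> $$ (i, j) \<partial>M)"

text \<open>
  A real Gaussian random variable may be degenerate (variance zero). This is needed for the
  noiseless case \<open>\<sigma>\<^sup>2 = 0\<close>.
\<close>

definition real_gaussian :: "'w measure \<Rightarrow> ('w \<Rightarrow> real) \<Rightarrow> bool" where
  "real_gaussian M X \<longleftrightarrow> X \<in> borel_measurable M \<and>
     ((\<exists>\<mu> s. s > 0 \<and> distributed M lborel X (normal_density \<mu> s)) \<or>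
      (\<exists>\<mu>. AE \<omega> in M. X \<omega> = \<mu>))"

text \<open>
  A complex vector is Gaussian if its real and imaginary parts are jointly Gaussian, i.e. every
  real linear combination of them is Gaussian.
\<close>

definition complex_gaussian_vector ::
  "'w measure \<Rightarrow> nat \<Rightarrow> (nat \<Rightarrow> 'w \<Rightarrow> complex) \<Rightarrow> bool" where
  "complex_gaussian_vector M n v \<longleftrightarrow>
     (\<forall>i<n. v i \<in> borel_measurable M) \<and>
     (\<forall>p q :: nat \<Rightarrow> real. real_gaussian M (\<lambda>\<omega>. \<Sum>i<n. p i * Re (v i \<omega>) + q i * Im (v i \<omega>)))"

abbreviation cvec_algebra :: "nat \<Rightarrow> (nat \<Rightarrow> complex) measure" where
  "cvec_algebra n \<equiv> PiM {..<n} (\<lambda>_. borel)"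

definition circularly_symmetric ::
  "'w measure \<Rightarrow> nat \<Rightarrow> (nat \<Rightarrow> 'w \<Rightarrow> complex) \<Rightarrow> bool" where
  "circularly_symmetric M n v \<longleftrightarrow>
     (\<forall>\<theta> :: real. distr M (cvec_algebra n) (\<lambda>\<omega>. \<lambda>i\<in>{..<n}. cis \<theta> * v i \<omega>) =
                  distr M (cvec_algebra n) (\<lambda>\<omega>. \<lambda>i\<in>{..<n}. v i \<omega>))"

definition pam_alphabet :: "real \<Rightarrow> nat \<Rightarrow> real set" where
  "pam_alphabet amp N = {real_of_int k * amp | k. odd k \<and> \<bar>k\<bar> \<le> int N - 1}"

definition oqam :: "(nat \<Rightarrow> 'w \<Rightarrow> real) \<Rightarrow> nat \<Rightarrow> 'w \<Rightarrow> complex" where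
  "oqam a n \<omega> = (if even n then complex_of_real (a n \<omega>) else \<i> * complex_of_real (a n \<omega>))"

text \<open>Since \<open>h\<close> is supported on \<open>{0..L}\<close>, summing over that range is summing over all integers.\<close>

definition channel_autocorr :: "nat \<Rightarrow> (int \<Rightarrow> complex) \<Rightarrow> int \<Rightarrow> complex" where
  "channel_autocorr L h k = (\<Sum>l\<in>{0..int L}. h (l + k) * cnj (h l))"

definition Gamma_mat :: "nat \<Rightarrow> nat \<Rightarrow> (int \<Rightarrow> complex) \<Rightarrow> complex mat" where
  "Gamma_mat \<nu> L h =
     Matrix.mat (2 * \<nu>) (2 * \<nu>) (\<lambda>(m, n). channel_autocorr L h (int m - int n))"

definition A_mat :: "nat \<Rightarrow> complex mat" where
  "A_mat \<nu> = mat_diag (2 * \<nu>) (\<lambda>n. if even n then 1 / 2 else - \<i> / 2)"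

definition B_mat :: "nat \<Rightarrow> complex mat" where
  "B_mat \<nu> = mat_diag (2 * \<nu>) (\<lambda>n. if even n then 1 else - 1)"

definition Gamma_a_mat :: "nat \<Rightarrow> nat \<Rightarrow> (int \<Rightarrow> complex) \<Rightarrow> complex mat" where
  "Gamma_a_mat \<nu> L h =
     2 \<cdot>\<^sub>m (A_mat \<nu> * (Gamma_mat \<nu> L h + B_mat \<nu> * transpose_mat (Gamma_mat \<nu> L h) * B_mat \<nu>)
           * mat_adjoint (A_mat \<nu>))"

definition a_vec :: "nat \<Rightarrow> (nat \<Rightarrow> 'w \<Rightarrow> real) \<Rightarrow> 'w \<Rightarrow> complex mat" where
  "a_vec \<nu> a \<omega> = col_vec (2 * \<nu>) (\<lambda>n. complex_of_real (a n \<omega>))"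

definition x_vec :: "nat \<Rightarrow> (nat \<Rightarrow> 'w \<Rightarrow> real) \<Rightarrow> 'w \<Rightarrow> complex mat" where
  "x_vec \<nu> a \<omega> = col_vec (2 * \<nu>) (\<lambda>n. oqam a n \<omega>)"

definition v_vec :: "nat \<Rightarrow> (nat \<Rightarrow> 'w \<Rightarrow> complex) \<Rightarrow> 'w \<Rightarrow> complex mat" where
  "v_vec \<nu> v \<omega> = col_vec (2 * \<nu>) (\<lambda>n. v n \<omega>)"

definition y_vec ::
  "nat \<Rightarrow> nat \<Rightarrow> (int \<Rightarrow> complex) \<Rightarrow> (nat \<Rightarrow> 'w \<Rightarrow> real) \<Rightarrow> (nat \<Rightarrow> 'w \<Rightarrow> complex) \<Rightarrow> 'w \<Rightarrow> complex mat"
  where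
  "y_vec \<nu> L h a v \<omega> = Gamma_mat \<nu> L h * x_vec \<nu> a \<omega> + v_vec \<nu> v \<omega>"

definition x_hat_LE ::
  "nat \<Rightarrow> nat \<Rightarrow> (int \<Rightarrow> complex) \<Rightarrow> real \<Rightarrow> (nat \<Rightarrow> 'w \<Rightarrow> real) \<Rightarrow> (nat \<Rightarrow> 'w \<Rightarrow> complex) \<Rightarrow> 'w \<Rightarrow> complex mat"
  where
  "x_hat_LE \<nu> L h \<sigma>2 a v \<omega> =
     minv (Gamma_mat \<nu> L h + complex_of_real \<sigma>2 \<cdot>\<^sub>m 1\<^sub>m (2 * \<nu>)) * y_vec \<nu> L h a v \<omega>"

definition y_a_vec ::
  "nat \<Rightarrow> nat \<Rightarrow> (int \<Rightarrow> complex) \<Rightarrow> (nat \<Rightarrow> 'w \<Rightarrow> real) \<Rightarrow> (nat \<Rightarrow> 'w \<Rightarrow> complex) \<Rightarrow> 'w \<Rightarrow> complex mat"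
  where
  "y_a_vec \<nu> L h a v \<omega> =
     A_mat \<nu> * (y_vec \<nu> L h a v \<omega> + B_mat \<nu> * mat_cnj (y_vec \<nu> L h a v \<omega>))"

definition a_hat_ROE ::
  "nat \<Rightarrow> nat \<Rightarrow> (int \<Rightarrow> complex) \<Rightarrow> real \<Rightarrow> (nat \<Rightarrow> 'w \<Rightarrow> real) \<Rightarrow> (nat \<Rightarrow> 'w \<Rightarrow> complex) \<Rightarrow> 'w \<Rightarrow> complex mat"
  where
  "a_hat_ROE \<nu> L h \<sigma>2 a v \<omega> =
     minv (Gamma_a_mat \<nu> L h + complex_of_real (\<sigma>2 / 2) \<cdot>\<^sub>m 1\<^sub>m (2 * \<nu>)) * y_a_vec \<nu> L h a v \<omega>"

text \<open>
  The diagonal entries of \<open>e e\<dagger>\<close> are \<open>\<bar>e\<^sub>i\<bar>\<^sup>2\<close>, so the trace below is real and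
  taking \<open>Re\<close> is only a conversion of type.
\<close>

definition avg_mse :: "'w measure \<Rightarrow> nat \<Rightarrow> ('w \<Rightarrow> complex mat) \<Rightarrow> real" where
  "avg_mse M n e = 1 / real n * Re (mat_tr (expect_mat M n n (\<lambda>\<omega>. e \<omega> * mat_adjoint (e \<omega>))))"

definition MMSE_LE ::
  "'w measure \<Rightarrow> nat \<Rightarrow> nat \<Rightarrow> (int \<Rightarrow> complex) \<Rightarrow> real \<Rightarrow> (nat \<Rightarrow> 'w \<Rightarrow> real) \<Rightarrow> (nat \<Rightarrow> 'w \<Rightarrow> complex) \<Rightarrow> real"
  where
  "MMSE_LE M \<nu> L h \<sigma>2 a v =
     avg_mse M (2 * \<nu>) (\<lambda>\<omega>. x_vec \<nu> a \<omega> - x_hat_LE \<nu> L h \<sigma>2 a v \<omega>)"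

definition MMSE_ROE ::
  "'w measure \<Rightarrow> nat \<Rightarrow> nat \<Rightarrow> (int \<Rightarrow> complex) \<Rightarrow> real \<Rightarrow> (nat \<Rightarrow> 'w \<Rightarrow> real) \<Rightarrow> (nat \<Rightarrow> 'w \<Rightarrow> complex) \<Rightarrow> real"
  where
  "MMSE_ROE M \<nu> L h \<sigma>2 a v =
     avg_mse M (2 * \<nu>) (\<lambda>\<omega>. a_vec \<nu> a \<omega> - a_hat_ROE \<nu> L h \<sigma>2 a v \<omega>)"

end

(* With P = Gamma + sigma^2 I, the LE error covariance is sigma^2 P^-1. Since x = 2 A^dagger a and
   A A^dagger = I/4, the ROE matrix is Gamma_a + sigma^2/2 I = 2 A (P + Q) A^dagger with
   Q = B Gamma^T B, so the trace of the ROE error covariance is sigma^2 tr (P + Q)^-1. As Q is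
   positive definite, tr (P + Q)^-1 <= tr P^-1. Strict positive definiteness of Gamma (a product of
   two nonzero finitely supported sequences under convolution is nonzero) keeps all inverses
   meaningful in the noiseless case sigma = 0. *)

theory Submission
  imports Defs
begin

section \<open>Positive definite matrices\<close>

text \<open>Both error figures are defined as expectations of actual errors, so their closed forms
  have to be derived from the signal model. One computation serves both equalizers: if the signal
  has identity covariance, the noise covariance is s G and the two are uncorrelated, then the
  estimator (G + s I)^-1 leaves the error covariance s (G + s I)^-1. The pair (G, s) is (Gamma,
  \<open>\<sigma>2\<close>) for LE and (Gamma_a, \<open>\<sigma>2 / 2\<close>) for ROE. Q is the
  gain from the OQAM structure: the entries of x are alternately real and purely imaginary, so conj
  x = B x, and B conj y = B Gamma^T B x + B conj v is a second observation of the same x. E[v v^T] =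
  0 makes the noises of the two observations uncorrelated, so their covariances add. As 2 A is
  unitary, the real problem is a rotated copy, scaled by one half, of the problem for Gamma + Q; the
  scale cancels between \<open>\<sigma>2 / 2\<close> and the trace of the inverse.\<close>

lemma dim_mat_adjoint [simp]:
  "dim_row (mat_adjoint X) = dim_col X" "dim_col (mat_adjoint X) = dim_row X"
  by (simp_all add: mat_adjoint_def)

lemma mat_adjoint_carrier [simp]: "X \<in> carrier_mat n m \<Longrightarrow> mat_adjoint X \<in> carrier_mat m n"
  by (intro carrier_matI) auto

lemma index_mat_adjoint [simp]:
  "i < dim_col X \<Longrightarrow> j < dim_row X \<Longrightarrow> mat_adjoint X $$ (i, j) = cnj (X $$ (j, i))"
  by (simp add: mat_adjoint_def mat_of_rows_index)

lemma index_mult_mat_sum: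
  assumes "X \<in> carrier_mat n k" "Y \<in> carrier_mat k m" "i < n" "j < m"
  shows "(X * Y) $$ (i, j) = (\<Sum>l<k. X $$ (i, l) * Y $$ (l, j))"
  using assms by (simp add: scalar_prod_def atLeast0LessThan)

lemma mat_adjoint_mult:
  fixes X Y :: "complex mat"
  assumes "X \<in> carrier_mat n k" "Y \<in> carrier_mat k m"
  shows "mat_adjoint (X * Y) = mat_adjoint Y * mat_adjoint X"
  using carrier_matD[OF assms(1)] carrier_matD[OF assms(2)]
  by (intro eq_matI) (auto simp: scalar_prod_def mult.commute)

lemma mat_adjoint_add:
  fixes X Y :: "complex mat"
  assumes "X \<in> carrier_mat n m" "Y \<in> carrier_mat n m"
  shows "mat_adjoint (X + Y) = mat_adjoint X + mat_adjoint Y"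
  using carrier_matD[OF assms(1)] carrier_matD[OF assms(2)] by (intro eq_matI) auto

lemma mat_adjoint_adjoint [simp]: "mat_adjoint (mat_adjoint (X :: complex mat)) = X"
  by (intro eq_matI) auto

lemma mat_adjoint_smult: "mat_adjoint (c \<cdot>\<^sub>m X) = cnj c \<cdot>\<^sub>m mat_adjoint X"
  by (intro eq_matI) auto

lemma mat_adjoint_one [simp]: "mat_adjoint (1\<^sub>m n :: complex mat) = 1\<^sub>m n"
  by (intro eq_matI) auto

lemma cscalar_prod_adjoint:
  fixes X :: "complex mat"
  assumes X: "X \<in> carrier_mat n m" and z: "z \<in> carrier_vec m" and w: "w \<in> carrier_vec n"
  shows "(X *\<^sub>v z) \<bullet>c w = z \<bullet>c (mat_adjoint X *\<^sub>v w)"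
proof -
  have "(X *\<^sub>v z) \<bullet>c w = (\<Sum>i<n. \<Sum>j<m. X $$ (i, j) * vec_index z j * cnj (vec_index w i))"
    using assms by (simp add: scalar_prod_def atLeast0LessThan sum_distrib_right)
  also have "\<dots> = (\<Sum>j<m. \<Sum>i<n. X $$ (i, j) * vec_index z j * cnj (vec_index w i))"
    by (rule sum.swap)
  also have "\<dots> = z \<bullet>c (mat_adjoint X *\<^sub>v w)"
    using assms by (simp add: scalar_prod_def atLeast0LessThan sum_distrib_left mult_ac)
  finally show ?thesis .
qed

text \<open>The Hermitian condition makes the quadratic form real, so \<open>Re\<close> only
  converts the type. Positivity is strict because invertibility is derived from it.\<close>

definition pos_def :: "nat \<Rightarrow> complex mat \<Rightarrow> bool" where
  "pos_def n X \<longleftrightarrow> X \<in> carrier_mat n n \<and> mat_adjoint X = X \<and>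
     (\<forall>z\<in>carrier_vec n. z \<noteq> 0\<^sub>v n \<longrightarrow> 0 < Re ((X *\<^sub>v z) \<bullet>c z))"

lemma pos_def_carrier [simp]: "pos_def n X \<Longrightarrow> X \<in> carrier_mat n n"
  and pos_def_hermitian: "pos_def n X \<Longrightarrow> mat_adjoint X = X"
  by (simp_all add: pos_def_def)

lemma pos_def_pos:
  "pos_def n X \<Longrightarrow> z \<in> carrier_vec n \<Longrightarrow> z \<noteq> 0\<^sub>v n \<Longrightarrow> 0 < Re ((X *\<^sub>v z) \<bullet>c z)"
  by (simp add: pos_def_def)

lemma pos_def_add:
  assumes X: "pos_def n X" and Y: "pos_def n Y"
  shows "pos_def n (X + Y)"
  unfolding pos_def_def
proof (intro conjI ballI impI)
  show "X + Y \<in> carrier_mat n n"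
    using X Y by simp
  show "mat_adjoint (X + Y) = X + Y"
    using mat_adjoint_add[OF pos_def_carrier[OF X] pos_def_carrier[OF Y]] X Y
    by (simp add: pos_def_hermitian)
  fix z :: "complex vec" assume z: "z \<in> carrier_vec n" "z \<noteq> 0\<^sub>v n"
  have c: "X *\<^sub>v z \<in> carrier_vec n" "Y *\<^sub>v z \<in> carrier_vec n"
    using X Y z by (auto intro!: mult_mat_vec_carrier[of _ n n])
  have "((X + Y) *\<^sub>v z) \<bullet>c z = (X *\<^sub>v z) \<bullet>c z + (Y *\<^sub>v z) \<bullet>c z"
    using X Y z c by (simp add: add_mult_distrib_mat_vec[of _ n n] add_scalar_prod_distrib[of _ n])
  then show "0 < Re (((X + Y) *\<^sub>v z) \<bullet>c z)"
    using pos_def_pos[OF X z] pos_def_pos[OF Y z] by simp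
qed

text \<open>\<open>s = 0\<close> is the noiseless case, where the added multiple of the identity is
  only semidefinite; strictness comes from \<open>X\<close> alone.\<close>

lemma pos_def_add_scalar:
  assumes X: "pos_def n X" and s: "0 \<le> s"
  shows "pos_def n (X + complex_of_real s \<cdot>\<^sub>m 1\<^sub>m n)"
  unfolding pos_def_def
proof (intro conjI ballI impI)
  show "X + complex_of_real s \<cdot>\<^sub>m 1\<^sub>m n \<in> carrier_mat n n"
    using X by simp
  show "mat_adjoint (X + complex_of_real s \<cdot>\<^sub>m 1\<^sub>m n) = X + complex_of_real s \<cdot>\<^sub>m 1\<^sub>m n"
    using X mat_adjoint_add[OF pos_def_carrier[OF X], of "complex_of_real s \<cdot>\<^sub>m 1\<^sub>m n"]
    by (simp add: pos_def_hermitian mat_adjoint_smult)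
  fix z :: "complex vec" assume z: "z \<in> carrier_vec n" "z \<noteq> 0\<^sub>v n"
  have c: "X *\<^sub>v z \<in> carrier_vec n" "complex_of_real s \<cdot>\<^sub>v z \<in> carrier_vec n"
    using X z by (auto intro!: mult_mat_vec_carrier[of _ n n])
  have "(complex_of_real s \<cdot>\<^sub>m 1\<^sub>m n) *\<^sub>v z = complex_of_real s \<cdot>\<^sub>v z"
    using z by (intro eq_vecI) auto
  then have "((X + complex_of_real s \<cdot>\<^sub>m 1\<^sub>m n) *\<^sub>v z) \<bullet>c z
      = (X *\<^sub>v z) \<bullet>c z + complex_of_real s * (z \<bullet>c z)"
    using X z c by (simp add: add_mult_distrib_mat_vec[of _ n n] add_scalar_prod_distrib[of _ n])
  moreover have "0 \<le> Re (z \<bullet>c z)"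
    using conjugate_square_ge_0_vec[of z] by (simp add: less_eq_complex_def)
  ultimately show "0 < Re (((X + complex_of_real s \<cdot>\<^sub>m 1\<^sub>m n) *\<^sub>v z) \<bullet>c z)"
    using pos_def_pos[OF X z] s by (simp add: add_pos_nonneg)
qed

text \<open>The form of the congruent matrix at \<open>z\<close> is the form of \<open>X\<close> at
  \<open>S z\<close>, and the left inverse \<open>T\<close> keeps \<open>S z\<close> away from
  zero.\<close>

lemma pos_def_congruence:
  assumes X: "pos_def n X" and S: "S \<in> carrier_mat n n" and T: "T \<in> carrier_mat n n"
    and TS: "T * S = 1\<^sub>m n"
  shows "pos_def n (mat_adjoint S * X * S)"
  unfolding pos_def_def
proof (intro conjI ballI impI)
  show "mat_adjoint S * X * S \<in> carrier_mat n n"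
    using X S by (intro mult_carrier_mat[of _ _ n]) auto
  have Sa: "mat_adjoint S \<in> carrier_mat n n" and SX: "mat_adjoint S * X \<in> carrier_mat n n"
    using X S by (auto intro!: mult_carrier_mat[of _ n n])
  show "mat_adjoint (mat_adjoint S * X * S) = mat_adjoint S * X * S"
    unfolding mat_adjoint_mult[OF SX S] mat_adjoint_mult[OF Sa pos_def_carrier[OF X]]
    by (simp add: pos_def_hermitian[OF X] assoc_mult_mat[OF Sa pos_def_carrier[OF X] S])
  fix z :: "complex vec" assume z: "z \<in> carrier_vec n" "z \<noteq> 0\<^sub>v n"
  have c: "S *\<^sub>v z \<in> carrier_vec n"
    using S z by (auto intro!: mult_mat_vec_carrier[of _ n n])
  have "S *\<^sub>v z \<noteq> 0\<^sub>v n"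
  proof
    assume "S *\<^sub>v z = 0\<^sub>v n"
    then have "T *\<^sub>v (S *\<^sub>v z) = 0\<^sub>v n"
      using T by (intro eq_vecI) (auto simp: scalar_prod_def)
    then have "(T * S) *\<^sub>v z = 0\<^sub>v n"
      using T S z by (simp add: assoc_mult_mat_vec[of _ n n _ n])
    then show False
      using TS z by simp
  qed
  then have "0 < Re ((X *\<^sub>v (S *\<^sub>v z)) \<bullet>c (S *\<^sub>v z))"
    using pos_def_pos[OF X c] by simp
  also have "(X *\<^sub>v (S *\<^sub>v z)) \<bullet>c (S *\<^sub>v z) = (mat_adjoint S *\<^sub>v (X *\<^sub>v (S *\<^sub>v z))) \<bullet>c z"
    using X S Sa z c by (subst cscalar_prod_adjoint[OF Sa]) (auto intro!: mult_mat_vec_carrier[of _ n n])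
  also have "mat_adjoint S *\<^sub>v (X *\<^sub>v (S *\<^sub>v z)) = (mat_adjoint S * X * S) *\<^sub>v z"
    using X S Sa SX z c by (simp add: assoc_mult_mat_vec[of _ n n _ n])
  finally show "0 < Re (((mat_adjoint S * X * S) *\<^sub>v z) \<bullet>c z)" .
qed

section \<open>Inverses\<close>

lemma minv_unit:
  assumes X: "X \<in> carrier_mat n n" and U: "X \<in> Units (ring_mat TYPE(complex) n ())"
  shows "minv X \<in> carrier_mat n n" "X * minv X = 1\<^sub>m n" "minv X * X = 1\<^sub>m n"
proof -
  obtain Y where "mat_inverse X = Some Y"
    using mat_inverse(1)[OF X, of "()"] U by (cases "mat_inverse X") auto
  with mat_inverse(2)[OF X this]
  show "minv X \<in> carrier_mat n n" "X * minv X = 1\<^sub>m n" "minv X * X = 1\<^sub>m n"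
    by (simp_all add: minv_def)
qed

lemma mat_left_inverse_unique:
  assumes X: "X \<in> carrier_mat n n" and Y: "Y \<in> carrier_mat n n" and Z: "Z \<in> carrier_mat n n"
    and YX: "Y * X = 1\<^sub>m n" and XZ: "X * Z = (1\<^sub>m n :: 'a :: semiring_1 mat)"
  shows "Y = Z"
proof -
  have "Y = Y * (X * Z)" using Y XZ by simp
  also have "\<dots> = Z" using X Y Z YX by (simp flip: assoc_mult_mat[of Y n n X n Z n])
  finally show ?thesis .
qed

lemma minv_eqI:
  assumes X: "X \<in> carrier_mat n n" and Y: "Y \<in> carrier_mat n n"
    and XY: "X * Y = 1\<^sub>m n" and YX: "Y * X = 1\<^sub>m n"
  shows "minv X = Y"
proof -
  have "X \<in> Units (ring_mat TYPE(complex) n ())"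
    using assms by (auto simp: Units_def ring_mat_def)
  from minv_unit[OF X this] show ?thesis
    by (intro mat_left_inverse_unique[OF X _ Y _ XY]) auto
qed

text \<open>A kernel vector would make the quadratic form vanish, so the determinant is nonzero. The
  adjoint of the inverse is again a left inverse, hence equals it, and X^-1 = X^-1 X X^-1 is then a
  congruence of \<open>X\<close>.\<close>

lemma pos_def_minv:
  assumes X: "pos_def n X"
  shows minv_carrier [simp]: "minv X \<in> carrier_mat n n"
    and minv_right: "X * minv X = 1\<^sub>m n" and minv_left: "minv X * X = 1\<^sub>m n"
    and minv_pos_def: "pos_def n (minv X)"
proof -
  have c: "X \<in> carrier_mat n n" using X by simp
  have "Determinant.det X \<noteq> 0"
  proof
    assume "Determinant.det X = 0"
    then obtain z where z: "z \<in> carrier_vec n" "z \<noteq> 0\<^sub>v n" "X *\<^sub>v z = 0\<^sub>v n"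
      using det_0_iff_vec_prod_zero[OF c] by auto
    then show False using pos_def_pos[OF X z(1,2)] by simp
  qed
  then have "X \<in> Units (ring_mat TYPE(complex) n ())"
    by (rule det_non_zero_imp_unit[OF c])
  note inv = minv_unit[OF c this]
  have "mat_adjoint (minv X) * X = mat_adjoint (X * minv X)"
    using inv(1) c X by (simp add: mat_adjoint_mult[of _ n n _ n] pos_def_hermitian)
  then have herm: "mat_adjoint (minv X) = minv X"
    using inv c by (intro mat_left_inverse_unique[OF c _ inv(1) _ inv(2)]) auto
  have "pos_def n (mat_adjoint (minv X) * X * minv X)"
    by (rule pos_def_congruence[OF X inv(1) c inv(2)])
  then show "pos_def n (minv X)"
    using herm inv by simp
  show "minv X \<in> carrier_mat n n" "X * minv X = 1\<^sub>m n" "minv X * X = 1\<^sub>m n"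
    by (rule inv)+
qed

section \<open>Traces and their monotonicity under inversion\<close>

lemma mat_tr_add:
  assumes "X \<in> carrier_mat n n" "Y \<in> carrier_mat n n"
  shows "mat_tr (X + Y) = mat_tr X + mat_tr Y"
  using assms by (simp add: mat_tr_def sum.distrib)

lemma mat_tr_smult: "X \<in> carrier_mat n n \<Longrightarrow> mat_tr (c \<cdot>\<^sub>m X) = c * mat_tr X"
  by (simp add: mat_tr_def sum_distrib_left)

lemma mat_tr_mult_comm:
  assumes "X \<in> carrier_mat n m" "Y \<in> carrier_mat m n"
  shows "mat_tr (X * Y) = mat_tr (Y * X)"
proof -
  have "mat_tr (X * Y) = (\<Sum>i<n. \<Sum>j<m. X $$ (i, j) * Y $$ (j, i))"
    using assms by (simp add: mat_tr_def index_mult_mat_sum[OF assms] del: index_mult_mat(1))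
  also have "\<dots> = (\<Sum>j<m. \<Sum>i<n. X $$ (i, j) * Y $$ (j, i))"
    by (rule sum.swap)
  also have "\<dots> = mat_tr (Y * X)"
    using assms by (simp add: mat_tr_def index_mult_mat_sum[OF assms(2,1)] mult.commute
        del: index_mult_mat(1))
  finally show ?thesis .
qed

text \<open>The diagonal entries are values of the quadratic form at the unit vectors.\<close>

lemma pos_def_trace_nonneg:
  assumes X: "pos_def n X"
  shows "0 \<le> Re (mat_tr X)"
proof -
  have "0 \<le> Re (X $$ (i, i))" if "i < n" for i
  proof -
    have "X *\<^sub>v unit_vec n i = col X i"
      using carrier_matD[OF pos_def_carrier[OF X]] that by (intro eq_vecI) auto
    moreover have "conjugate (unit_vec n i) = (unit_vec n i :: complex vec)"
      by (intro eq_vecI) (auto simp: unit_vec_def)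
    ultimately have "(X *\<^sub>v unit_vec n i) \<bullet>c unit_vec n i = X $$ (i, i)"
      using carrier_matD[OF pos_def_carrier[OF X]] that by (simp add: scalar_prod_right_unit)
    moreover have "unit_vec n i \<noteq> (0\<^sub>v n :: complex vec)"
      using that by simp
    ultimately show ?thesis
      using pos_def_pos[OF X, of "unit_vec n i"] by simp
  qed
  then show ?thesis
    using carrier_matD[OF pos_def_carrier[OF X]] by (auto simp: mat_tr_def intro!: sum_nonneg)
qed

text \<open>The difference of the two inverses is a congruence of a positive definite matrix, whose
  trace is nonnegative. It is found by expanding (P + Q) P^-1 (P + Q) = (P + Q) + Q + Q P^-1 Q and
  multiplying by (P + Q)^-1 on both sides.\<close>

lemma trace_minv_antimono:
  assumes P: "pos_def n P" and Q: "pos_def n Q"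
  shows "Re (mat_tr (minv (P + Q))) \<le> Re (mat_tr (minv P))"
proof -
  define Y where "Y = P + Q"
  have Y: "pos_def n Y"
    unfolding Y_def by (rule pos_def_add[OF P Q])
  define R where "R = minv P"
  define S where "S = minv Y"
  define Z where "Z = Q + Q * R * Q"
  note P_inv = pos_def_minv[OF P, folded R_def]
  note Q_inv = pos_def_minv[OF Q]
  note Y_inv = pos_def_minv[OF Y, folded S_def]
  have c [simp]: "P \<in> carrier_mat n n" "Q \<in> carrier_mat n n" "Y \<in> carrier_mat n n"
    "R \<in> carrier_mat n n" "S \<in> carrier_mat n n"
    using P Q Y P_inv Y_inv by auto
  note [simp] = mult_carrier_mat[of _ n n _ n] left_mult_one_mat[of _ n n] right_mult_one_mat[of _ n n]
  \<comment> \<open>A congruence of \<open>R\<close> by \<open>Q\<close>, which is Hermitian and,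
    being positive definite, invertible.\<close>
  have QRQ: "pos_def n (Q * R * Q)"
    using pos_def_congruence[OF P_inv(4) c(2) Q_inv(1,3)] by (simp add: pos_def_hermitian[OF Q])
  have Z: "pos_def n Z"
    unfolding Z_def by (rule pos_def_add[OF Q QRQ])
  have SZS: "pos_def n (S * Z * S)"
    using pos_def_congruence[OF Z c(5,3) Y_inv(2)] by (simp add: pos_def_hermitian[OF Y_inv(4)])
  have [simp]: "Z \<in> carrier_mat n n"
    using Z by simp
  have "Y * R = 1\<^sub>m n + Q * R"
    unfolding Y_def by (simp add: add_mult_distrib_mat[of _ n n _ _ n] P_inv)
  then have "Y * R * Y = Y + Q * R * Y"
    by (simp add: add_mult_distrib_mat[of _ n n _ _ n])
  also have "Q * R * Y = Q * R * P + Q * R * Q"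
    unfolding Y_def by (simp add: mult_add_distrib_mat[of _ n n _ n])
  also have "Q * R * P = Q"
    by (simp add: P_inv assoc_mult_mat[of _ n n _ n _ n])
  finally have YRY: "Y * R * Y = Y + Z"
    unfolding Z_def .
  (* P^-1 = Y^-1 + Y^-1 (Q + Q P^-1 Q) Y^-1, and the second summand is positive definite *)
  have "R = (S * Y) * R * (Y * S)"
    by (simp add: Y_inv)
  also have "\<dots> = S * (Y * R * Y) * S"
    by (simp add: assoc_mult_mat[of _ n n _ n _ n])
  also have "\<dots> = S * Y * S + S * Z * S"
    by (simp add: YRY mult_add_distrib_mat[of _ n n _ n] add_mult_distrib_mat[of _ n n _ _ n])
  also have "\<dots> = S + S * Z * S"
    by (simp add: Y_inv)
  finally have "mat_tr R = mat_tr S + mat_tr (S * Z * S)"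
    using SZS mat_tr_add[of S n "S * Z * S"] by simp
  with pos_def_trace_nonneg[OF SZS] show ?thesis
    unfolding R_def S_def Y_def by simp
qed

text \<open>The transpose of a Hermitian matrix is its entrywise conjugate, so its form at
  \<open>z\<close> is the conjugate of the form of \<open>X\<close> at the conjugate of
  \<open>z\<close>.\<close>

lemma pos_def_transpose:
  assumes X: "pos_def n X"
  shows "pos_def n (transpose_mat X)"
  unfolding pos_def_def
proof (intro conjI ballI impI)
  have c: "X \<in> carrier_mat n n" using X by simp
  have herm: "cnj (X $$ (i, j)) = X $$ (j, i)" if "i < n" "j < n" for i j
    using arg_cong[OF pos_def_hermitian[OF X], of "\<lambda>Y. Y $$ (j, i)"] that c by simp
  have tr: "X $$ (i, j) = cnj (transpose_mat X $$ (i, j))" if "i < n" "j < n" for i j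
    using herm[OF that(2,1)] that c by simp
  show "transpose_mat X \<in> carrier_mat n n" using c by simp
  show "mat_adjoint (transpose_mat X) = transpose_mat X"
    using c herm by (intro eq_matI) auto
  fix z :: "complex vec" assume z: "z \<in> carrier_vec n" "z \<noteq> 0\<^sub>v n"
  then have "conjugate z \<noteq> 0\<^sub>v n"
    by simp
  then have "0 < Re ((X *\<^sub>v conjugate z) \<bullet>c conjugate z)"
    using pos_def_pos[OF X, of "conjugate z"] z by simp
  also have "(X *\<^sub>v conjugate z) \<bullet>c conjugate z = cnj ((transpose_mat X *\<^sub>v z) \<bullet>c z)"
  proof -
    have "(X *\<^sub>v conjugate z) \<bullet>c conjugate z
        = (\<Sum>i<n. (\<Sum>j<n. X $$ (i, j) * cnj (vec_index z j)) * vec_index z i)"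
      using c z by (simp add: scalar_prod_def atLeast0LessThan)
    also have "\<dots> = (\<Sum>i<n. (\<Sum>j<n. cnj (transpose_mat X $$ (i, j) * vec_index z j)) * vec_index z i)"
      by (intro sum.cong refl arg_cong2[where f = "(*)"]) (simp_all only: lessThan_iff tr complex_cnj_mult complex_cnj_cnj)
    also have "\<dots> = cnj ((transpose_mat X *\<^sub>v z) \<bullet>c z)"
      using c z by (simp add: scalar_prod_def atLeast0LessThan)
    finally show ?thesis .
  qed
  finally show "0 < Re ((transpose_mat X *\<^sub>v z) \<bullet>c z)"
    by simp
qed

section \<open>The channel matrices\<close>

lemma mat_adjoint_diag: "mat_adjoint (mat_diag n f) = mat_diag n (\<lambda>i. cnj (f i))"
  by (intro eq_matI) (auto simp: mat_diag_def)

lemma A_mat_carrier [simp]: "A_mat \<nu> \<in> carrier_mat (2 * \<nu>) (2 * \<nu>)"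
  and B_mat_carrier [simp]: "B_mat \<nu> \<in> carrier_mat (2 * \<nu>) (2 * \<nu>)"
  and Gamma_mat_carrier [simp]: "Gamma_mat \<nu> L h \<in> carrier_mat (2 * \<nu>) (2 * \<nu>)"
  by (simp_all add: A_mat_def B_mat_def Gamma_mat_def)

lemma A_mat_adjoint: "A_mat \<nu> * mat_adjoint (A_mat \<nu>) = (1 / 4) \<cdot>\<^sub>m 1\<^sub>m (2 * \<nu>)"
  "mat_adjoint (A_mat \<nu>) * A_mat \<nu> = (1 / 4) \<cdot>\<^sub>m 1\<^sub>m (2 * \<nu>)"
  by (simp_all add: A_mat_def mat_adjoint_diag, auto simp: mat_diag_def intro!: eq_matI)

lemma B_mat_adjoint [simp]: "mat_adjoint (B_mat \<nu>) = B_mat \<nu>"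
  by (simp add: B_mat_def mat_adjoint_diag if_distrib cong: if_cong)

lemma B_mat_square: "B_mat \<nu> * B_mat \<nu> = 1\<^sub>m (2 * \<nu>)"
  by (simp add: B_mat_def, auto simp: mat_diag_def intro!: eq_matI)

text \<open>The substitution t = l + m yields a correlation of two shifted copies of
  \<open>h\<close>. The window is then enlarged to one common to all \<open>m < K\<close> and all
  \<open>n\<close>, which permits interchanging sums later; the added terms vanish because
  \<open>h (t - int m)\<close> does.\<close>

lemma channel_autocorr_correlation:
  assumes h_supp: "\<And>k. k < 0 \<or> k > int L \<Longrightarrow> h k = 0" and m: "m < K"
  shows "channel_autocorr L h (int m - int n)
    = (\<Sum>t\<in>{0..int (L + K)}. h (t - int n) * cnj (h (t - int m)))"
proof -
  have "channel_autocorr L h (int m - int n)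
      = (\<Sum>t\<in>{int m..int L + int m}. h (t - int n) * cnj (h (t - int m)))"
    unfolding channel_autocorr_def
    by (rule sum.reindex_bij_witness[where i = "\<lambda>t. t - int m" and j = "\<lambda>l. l + int m"])
      (auto simp: algebra_simps)
  also have "\<dots> = (\<Sum>t\<in>{0..int (L + K)}. h (t - int n) * cnj (h (t - int m)))"
    using m by (intro sum.mono_neutral_left) (auto intro!: h_supp)
  finally show ?thesis .
qed

text \<open>This supplies strictness in the positive definiteness of \<open>Gamma_mat\<close>:
  convolution with \<open>h\<close> has trivial kernel. The window is that of
  \<open>channel_autocorr_correlation\<close>.\<close>

lemma convolution_nonzero:
  fixes h :: "int \<Rightarrow> complex" and f :: "nat \<Rightarrow> complex"
  assumes h_supp: "\<And>k. k < 0 \<or> k > int L \<Longrightarrow> h k = 0" and h_nz: "h k \<noteq> 0"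
    and f: "m < K" "f m \<noteq> 0"
  shows "\<exists>t\<in>{0..int (L + K)}. (\<Sum>n<K. h (t - int n) * f n) \<noteq> 0"
proof -
  have k: "0 \<le> k" using h_supp[of k] h_nz by fastforce
  (* at the sum of the two smallest support points, only one term of the convolution survives *)
  define k0 where "k0 = (LEAST i. h (int i) \<noteq> 0)"
  define m0 where "m0 = (LEAST i. f i \<noteq> 0)"
  have k0: "h (int k0) \<noteq> 0"
    unfolding k0_def by (rule LeastI[of _ "nat k"]) (use h_nz k in simp)
  have k0_min: "h i = 0" if "i < int k0" for i
  proof (cases "i < 0")
    case True
    then show ?thesis using h_supp by blast
  next
    case False
    then have "nat i < k0" using that by simp
    then have "\<not> h (int (nat i)) \<noteq> 0" unfolding k0_def by (rule not_less_Least)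
    then show ?thesis using False by simp
  qed
  have m0: "f m0 \<noteq> 0"
    unfolding m0_def by (rule LeastI[of _ m]) (use f in simp)
  have m0_min: "f i = 0" if "i < m0" for i
    using not_less_Least[of i "\<lambda>i. f i \<noteq> 0"] that by (auto simp: m0_def)
  have "m0 \<le> m" unfolding m0_def using f by (intro Least_le) simp
  then have "m0 < K" using f by simp
  have "int k0 \<le> int L" using h_supp[of "int k0"] k0 by fastforce
  have "(\<Sum>n<K. h (int (k0 + m0) - int n) * f n) = (\<Sum>n\<in>{m0}. h (int (k0 + m0) - int n) * f n)"
  proof (rule sum.mono_neutral_right)
    show "\<forall>n\<in>{..<K} - {m0}. h (int (k0 + m0) - int n) * f n = 0"
    proof
      fix n assume n: "n \<in> {..<K} - {m0}"
      show "h (int (k0 + m0) - int n) * f n = 0"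
      proof (cases "n < m0")
        case True
        then show ?thesis by (simp add: m0_min)
      next
        case False
        with n have "int (k0 + m0) - int n < int k0" by auto
        then show ?thesis by (simp add: k0_min)
      qed
    qed
  qed (use \<open>m0 < K\<close> in auto)
  also have "\<dots> \<noteq> 0" using k0 m0 by simp
  finally show ?thesis
    using \<open>m0 < K\<close> \<open>int k0 \<le> int L\<close> by (intro bexI[of _ "int (k0 + m0)"]) auto
qed

text \<open>\<open>Gamma_mat\<close> is a Gram matrix of shifted copies of \<open>h\<close>: its
  form at \<open>z\<close> is the energy of the convolution \<open>u\<close> of \<open>h\<close>
  with \<open>z\<close>, a sum of squares with a nonzero term when \<open>z\<close> is
  nonzero.\<close>

lemma Gamma_mat_pos_def:
  assumes h_supp: "\<And>k. k < 0 \<or> k > int L \<Longrightarrow> h k = 0" and h_nz: "\<exists>k. h k \<noteq> 0"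
  shows "pos_def (2 * \<nu>) (Gamma_mat \<nu> L h)"
  unfolding pos_def_def
proof (intro conjI ballI impI)
  let ?T = "{0..int (L + 2 * \<nu>)}"
  have entry: "Gamma_mat \<nu> L h $$ (m, n) = (\<Sum>t\<in>?T. h (t - int n) * cnj (h (t - int m)))"
    if "m < 2 * \<nu>" "n < 2 * \<nu>" for m n
    using that by (simp add: Gamma_mat_def channel_autocorr_correlation[OF h_supp that(1)])
  have dim: "dim_row (Gamma_mat \<nu> L h) = 2 * \<nu>" "dim_col (Gamma_mat \<nu> L h) = 2 * \<nu>"
    by (simp_all add: Gamma_mat_def)
  show "Gamma_mat \<nu> L h \<in> carrier_mat (2 * \<nu>) (2 * \<nu>)" by simp
  show "mat_adjoint (Gamma_mat \<nu> L h) = Gamma_mat \<nu> L h"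
    by (intro eq_matI) (auto simp: dim entry mult.commute)
  fix z :: "complex vec" assume z: "z \<in> carrier_vec (2 * \<nu>)" "z \<noteq> 0\<^sub>v (2 * \<nu>)"
  define u where "u t = (\<Sum>n<2 * \<nu>. h (t - int n) * vec_index z n)" for t
  have "(Gamma_mat \<nu> L h *\<^sub>v z) \<bullet>c z
      = (\<Sum>m<2 * \<nu>. \<Sum>n<2 * \<nu>. Gamma_mat \<nu> L h $$ (m, n) * vec_index z n * cnj (vec_index z m))"
    using z by (simp add: scalar_prod_def atLeast0LessThan sum_distrib_right dim)
  also have "\<dots> = (\<Sum>m<2 * \<nu>. \<Sum>n<2 * \<nu>. \<Sum>t\<in>?T.
      (h (t - int n) * vec_index z n) * cnj (h (t - int m) * vec_index z m))"
    by (intro sum.cong refl) (simp add: entry sum_distrib_left sum_distrib_right mult_ac)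
  also have "\<dots> = (\<Sum>m<2 * \<nu>. \<Sum>t\<in>?T. \<Sum>n<2 * \<nu>.
      (h (t - int n) * vec_index z n) * cnj (h (t - int m) * vec_index z m))"
    by (intro sum.cong refl sum.swap)
  also have "\<dots> = (\<Sum>t\<in>?T. \<Sum>m<2 * \<nu>. \<Sum>n<2 * \<nu>.
      (h (t - int n) * vec_index z n) * cnj (h (t - int m) * vec_index z m))"
    by (rule sum.swap)
  also have "\<dots> = (\<Sum>t\<in>?T. u t * cnj (u t))"
    unfolding u_def by (intro sum.cong refl) (simp add: sum_product cnj_sum, rule sum.swap)
  also have "\<dots> = complex_of_real (\<Sum>t\<in>?T. (cmod (u t))\<^sup>2)"
    by (simp flip: complex_norm_square)
  finally have form: "Re ((Gamma_mat \<nu> L h *\<^sub>v z) \<bullet>c z) = (\<Sum>t\<in>?T. (cmod (u t))\<^sup>2)"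
    by simp
  obtain m where m: "m < 2 * \<nu>" "vec_index z m \<noteq> 0"
    using z by (metis carrier_vecD eq_vecI index_zero_vec)
  obtain k where "h k \<noteq> 0" using h_nz by blast
  then obtain t where "t \<in> ?T" "u t \<noteq> 0"
    using convolution_nonzero[of L h k m "2 * \<nu>" "vec_index z", OF h_supp] m unfolding u_def by blast
  then show "0 < Re ((Gamma_mat \<nu> L h *\<^sub>v z) \<bullet>c z)"
    unfolding form by (intro sum_pos2[of _ t]) auto
qed

text \<open>Since A A^H = I/4, the outer factor 2 and the congruence by A turn c I in the middle
  into (c/2) I. This explains why half of the noise level appears in the ROE.\<close>

lemma Gamma_a_mat_add_scalar:
  "Gamma_a_mat \<nu> L h + (c / 2) \<cdot>\<^sub>m 1\<^sub>m (2 * \<nu>) =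
    2 \<cdot>\<^sub>m (A_mat \<nu> * (Gamma_mat \<nu> L h + c \<cdot>\<^sub>m 1\<^sub>m (2 * \<nu>)
      + B_mat \<nu> * transpose_mat (Gamma_mat \<nu> L h) * B_mat \<nu>) * mat_adjoint (A_mat \<nu>))"
proof -
  let ?n = "2 * \<nu>"
  let ?G = "Gamma_mat \<nu> L h" and ?Q = "B_mat \<nu> * transpose_mat (Gamma_mat \<nu> L h) * B_mat \<nu>"
  have [simp]: "?Q \<in> carrier_mat ?n ?n"
    by (auto intro!: mult_carrier_mat[of _ ?n ?n])
  have "?G + c \<cdot>\<^sub>m 1\<^sub>m ?n + ?Q = (?G + ?Q) + c \<cdot>\<^sub>m 1\<^sub>m ?n"
    by (simp add: assoc_add_mat[of _ ?n ?n] comm_add_mat[of "c \<cdot>\<^sub>m 1\<^sub>m ?n" ?n ?n])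
  then have "A_mat \<nu> * (?G + c \<cdot>\<^sub>m 1\<^sub>m ?n + ?Q) * mat_adjoint (A_mat \<nu>)
      = A_mat \<nu> * (?G + ?Q) * mat_adjoint (A_mat \<nu>) + c \<cdot>\<^sub>m (A_mat \<nu> * mat_adjoint (A_mat \<nu>))"
    by (simp add: mult_add_distrib_mat[of _ ?n ?n _ ?n] add_mult_distrib_mat[of _ ?n ?n _ _ ?n]
        mult_smult_distrib[of _ ?n ?n _ ?n] mult_smult_assoc_mat[of _ ?n ?n _ ?n]
        mult_carrier_mat[of _ ?n ?n _ ?n] right_mult_one_mat[of _ ?n ?n])
  then show ?thesis
    unfolding Gamma_a_mat_def A_mat_adjoint
    by (intro eq_matI) (auto simp: A_mat_def mat_diag_def algebra_simps)
qed

section \<open>Second moments of random vectors\<close>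

text \<open>The Bochner integral of a non-integrable function is 0 by convention, so linearity of
  \<open>expect_mat\<close> is proved under integrability of the entries. Fixed dimensions at every
  \<open>\<omega>\<close> allow entries of sums and products to be rewritten under the
  integral.\<close>

definition mat_integrable :: "'w measure \<Rightarrow> nat \<Rightarrow> nat \<Rightarrow> ('w \<Rightarrow> complex mat) \<Rightarrow> bool" where
  "mat_integrable M n m X \<longleftrightarrow> (\<forall>\<omega>. X \<omega> \<in> carrier_mat n m) \<and>
     (\<forall>i<n. \<forall>j<m. integrable M (\<lambda>\<omega>. X \<omega> $$ (i, j)))"

lemma expect_mat_carrier [simp]: "expect_mat M n m X \<in> carrier_mat n m"
  by (simp add: expect_mat_def)

lemma expect_mat_index [simp]:
  "i < n \<Longrightarrow> j < m \<Longrightarrow> expect_mat M n m X $$ (i, j) = (\<integral>\<omega>. X \<omega> $$ (i, j) \<partial>M)"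
  by (simp add: expect_mat_def)

lemma mat_integrableD:
  assumes "mat_integrable M n m X"
  shows "X \<omega> \<in> carrier_mat n m" "dim_row (X \<omega>) = n" "dim_col (X \<omega>) = m"
    "i < n \<Longrightarrow> j < m \<Longrightarrow> integrable M (\<lambda>\<omega>. X \<omega> $$ (i, j))"
  using assms by (auto simp: mat_integrable_def)

lemma
  assumes X: "mat_integrable M n m X" and Y: "mat_integrable M n m Y"
  shows mat_integrable_add: "mat_integrable M n m (\<lambda>\<omega>. X \<omega> + Y \<omega>)"
    and expect_mat_add: "expect_mat M n m (\<lambda>\<omega>. X \<omega> + Y \<omega>) = expect_mat M n m X + expect_mat M n m Y"
proof -
  have idx: "(X \<omega> + Y \<omega>) $$ (i, j) = X \<omega> $$ (i, j) + Y \<omega> $$ (i, j)" if "i < n" "j < m" for \<omega> i j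
    using mat_integrableD(2,3)[OF Y] that by simp
  show "mat_integrable M n m (\<lambda>\<omega>. X \<omega> + Y \<omega>)"
    using X Y idx by (simp add: mat_integrable_def)
  show "expect_mat M n m (\<lambda>\<omega>. X \<omega> + Y \<omega>) = expect_mat M n m X + expect_mat M n m Y"
    using mat_integrableD(4)[OF X] mat_integrableD(4)[OF Y]
    by (intro eq_matI) (simp_all add: idx carrier_matD[OF expect_mat_carrier])
qed

lemma
  assumes X: "mat_integrable M n m X" and K: "K \<in> carrier_mat k n"
  shows mat_integrable_mult_left: "mat_integrable M k m (\<lambda>\<omega>. K * X \<omega>)"
    and expect_mat_mult_left: "expect_mat M k m (\<lambda>\<omega>. K * X \<omega>) = K * expect_mat M n m X"
proof -
  note idx = index_mult_mat_sum[OF K mat_integrableD(1)[OF X]]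
  show "mat_integrable M k m (\<lambda>\<omega>. K * X \<omega>)"
    using mat_integrableD[OF X] K
    by (auto simp: mat_integrable_def idx simp del: index_mult_mat(1) intro!: mult_carrier_mat[of _ _ n])
  show "expect_mat M k m (\<lambda>\<omega>. K * X \<omega>) = K * expect_mat M n m X"
  proof (rule eq_matI)
    fix i j assume "i < dim_row (K * expect_mat M n m X)" "j < dim_col (K * expect_mat M n m X)"
    then have ij: "i < k" "j < m"
      using K by (auto simp: expect_mat_def)
    have "expect_mat M k m (\<lambda>\<omega>. K * X \<omega>) $$ (i, j) = (\<Sum>l<n. K $$ (i, l) * (\<integral>\<omega>. X \<omega> $$ (l, j) \<partial>M))"
      using ij mat_integrableD(4)[OF X]
      by (simp add: idx integral_sum del: index_mult_mat(1))
    also have "\<dots> = (K * expect_mat M n m X) $$ (i, j)"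
      using ij by (subst index_mult_mat_sum[OF K expect_mat_carrier]) auto
    finally show "expect_mat M k m (\<lambda>\<omega>. K * X \<omega>) $$ (i, j) = (K * expect_mat M n m X) $$ (i, j)" .
  qed (use K in \<open>auto simp: expect_mat_def\<close>)
qed

lemma
  assumes X: "mat_integrable M n m X"
  shows mat_integrable_adjoint: "mat_integrable M m n (\<lambda>\<omega>. mat_adjoint (X \<omega>))"
    and expect_mat_adjoint: "expect_mat M m n (\<lambda>\<omega>. mat_adjoint (X \<omega>)) = mat_adjoint (expect_mat M n m X)"
proof -
  have idx: "mat_adjoint (X \<omega>) $$ (i, j) = cnj (X \<omega> $$ (j, i))" if "i < m" "j < n" for \<omega> i j
    using mat_integrableD(2,3)[OF X] that by simp
  show "mat_integrable M m n (\<lambda>\<omega>. mat_adjoint (X \<omega>))"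
    using X by (simp add: mat_integrable_def idx)
  show "expect_mat M m n (\<lambda>\<omega>. mat_adjoint (X \<omega>)) = mat_adjoint (expect_mat M n m X)"
    by (intro eq_matI) (simp_all add: idx carrier_matD[OF expect_mat_carrier])
qed

text \<open>Right multiplication by \<open>K\<close> is the adjoint of left multiplication of the
  adjoints, so the left version transfers.\<close>

lemma
  assumes X: "mat_integrable M n m X" and K: "K \<in> carrier_mat m k"
  shows mat_integrable_mult_right: "mat_integrable M n k (\<lambda>\<omega>. X \<omega> * K)"
    and expect_mat_mult_right: "expect_mat M n k (\<lambda>\<omega>. X \<omega> * K) = expect_mat M n m X * K"
proof -
  have Ka: "mat_adjoint K \<in> carrier_mat k m"
    using K by simp
  have eq: "X \<omega> * K = mat_adjoint (mat_adjoint K * mat_adjoint (X \<omega>))" for \<omega>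
    using mat_integrableD(1)[OF X] K by (simp add: mat_adjoint_mult[of _ k m _ n])
  note L = mat_integrable_mult_left[OF mat_integrable_adjoint[OF X] Ka]
    and E = expect_mat_mult_left[OF mat_integrable_adjoint[OF X] Ka]
  show "mat_integrable M n k (\<lambda>\<omega>. X \<omega> * K)"
    unfolding eq by (rule mat_integrable_adjoint[OF L])
  show "expect_mat M n k (\<lambda>\<omega>. X \<omega> * K) = expect_mat M n m X * K"
    unfolding eq expect_mat_adjoint[OF L] E expect_mat_adjoint[OF X]
    using K by (simp add: mat_adjoint_mult[of _ k m _ n])
qed

text \<open>The outer product expands into four terms. One mixed term is governed by E[p q^H] and
  the other by its adjoint, so a single vanishing cross-covariance removes both.\<close>

lemma
  fixes p q :: "'w \<Rightarrow> complex mat"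
  assumes p: "\<And>\<omega>. p \<omega> \<in> carrier_mat k r" and q: "\<And>\<omega>. q \<omega> \<in> carrier_mat l r"
    and F: "F \<in> carrier_mat n k" and G: "G \<in> carrier_mat n l"
    and pp: "mat_integrable M k k (\<lambda>\<omega>. p \<omega> * mat_adjoint (p \<omega>))"
    and pq: "mat_integrable M k l (\<lambda>\<omega>. p \<omega> * mat_adjoint (q \<omega>))"
    and qq: "mat_integrable M l l (\<lambda>\<omega>. q \<omega> * mat_adjoint (q \<omega>))"
    and uncorrelated: "expect_mat M k l (\<lambda>\<omega>. p \<omega> * mat_adjoint (q \<omega>)) = 0\<^sub>m k l"
  shows mat_integrable_covariance_linear:
      "mat_integrable M n n (\<lambda>\<omega>. (F * p \<omega> + G * q \<omega>) * mat_adjoint (F * p \<omega> + G * q \<omega>))"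
    and covariance_linear:
      "expect_mat M n n (\<lambda>\<omega>. (F * p \<omega> + G * q \<omega>) * mat_adjoint (F * p \<omega> + G * q \<omega>)) =
        F * expect_mat M k k (\<lambda>\<omega>. p \<omega> * mat_adjoint (p \<omega>)) * mat_adjoint F +
        G * expect_mat M l l (\<lambda>\<omega>. q \<omega> * mat_adjoint (q \<omega>)) * mat_adjoint G"
proof -
  let ?F = "mat_adjoint F" and ?G = "mat_adjoint G"
  have c: "?F \<in> carrier_mat k n" "?G \<in> carrier_mat l n"
    using F G by simp_all
  have pa: "mat_adjoint (p \<omega>) \<in> carrier_mat r k" and qa: "mat_adjoint (q \<omega>) \<in> carrier_mat r l" for \<omega>
    using p q by simp_all
  \<comment> \<open>Regroups each term so that the random outer product stands between two constant
    matrices, which then leave the expectation.\<close>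
  have *: "X * Y * mat_adjoint (X' * Y') = X * (Y * mat_adjoint Y') * mat_adjoint X'"
    if "X \<in> carrier_mat n a" "Y \<in> carrier_mat a r" "X' \<in> carrier_mat n b" "Y' \<in> carrier_mat b r"
    for X Y X' Y' :: "complex mat" and a b
    using that mult_carrier_mat[OF that(1,2)] mult_carrier_mat[OF that(2) mat_adjoint_carrier[OF that(4)]]
    by (simp add: mat_adjoint_mult[OF that(3,4)] assoc_mult_mat[of X n a Y r "mat_adjoint Y'" b]
        flip: assoc_mult_mat[of "X * Y" n r "mat_adjoint Y'" b "mat_adjoint X'" n])
  have expand: "(F * p \<omega> + G * q \<omega>) * mat_adjoint (F * p \<omega> + G * q \<omega>) =
      (F * (p \<omega> * mat_adjoint (p \<omega>)) * ?F + G * mat_adjoint (p \<omega> * mat_adjoint (q \<omega>)) * ?F) +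
      (F * (p \<omega> * mat_adjoint (q \<omega>)) * ?G + G * (q \<omega> * mat_adjoint (q \<omega>)) * ?G)" for \<omega>
  proof -
    have Fp: "F * p \<omega> \<in> carrier_mat n r" and Gq: "G * q \<omega> \<in> carrier_mat n r"
      using F G p q by (auto intro: mult_carrier_mat)
    have "(F * p \<omega> + G * q \<omega>) * mat_adjoint (F * p \<omega> + G * q \<omega>) =
      (F * p \<omega> * mat_adjoint (F * p \<omega>) + G * q \<omega> * mat_adjoint (F * p \<omega>)) +
      (F * p \<omega> * mat_adjoint (G * q \<omega>) + G * q \<omega> * mat_adjoint (G * q \<omega>))"
      using Fp Gq by (simp add: mat_adjoint_add[OF Fp Gq] add_mult_distrib_mat[of _ n r _ _ n]
          mult_add_distrib_mat[of _ n r _ n])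
    also have "mat_adjoint (p \<omega> * mat_adjoint (q \<omega>)) = q \<omega> * mat_adjoint (p \<omega>)"
      by (simp add: mat_adjoint_mult[OF p qa])
    ultimately show ?thesis
      by (simp add: *[OF F p F p] *[OF F p G q] *[OF G q F p] *[OF G q G q])
  qed
  note qp = mat_integrable_adjoint[OF pq]
  have sandwich: "mat_integrable M n n (\<lambda>\<omega>. X * Z \<omega> * Y)"
      "expect_mat M n n (\<lambda>\<omega>. X * Z \<omega> * Y) = X * expect_mat M a b Z * Y"
    if "mat_integrable M a b Z" "X \<in> carrier_mat n a" "Y \<in> carrier_mat b n" for X Y Z a b
    using mat_integrable_mult_right[OF mat_integrable_mult_left[OF that(1,2)] that(3)]
      expect_mat_mult_right[OF mat_integrable_mult_left[OF that(1,2)] that(3)]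
      expect_mat_mult_left[OF that(1,2)] by simp_all
  note S1 = sandwich[OF pp F c(1)] and S2 = sandwich[OF pq F c(2)]
    and S3 = sandwich[OF qp G c(1)] and S4 = sandwich[OF qq G c(2)]
  show "mat_integrable M n n (\<lambda>\<omega>. (F * p \<omega> + G * q \<omega>) * mat_adjoint (F * p \<omega> + G * q \<omega>))"
    unfolding expand by (intro mat_integrable_add S1 S2 S3 S4)
  have "mat_adjoint (0\<^sub>m k l) = (0\<^sub>m l k :: complex mat)"
    by (intro eq_matI) auto
  moreover have "F * expect_mat M k k (\<lambda>\<omega>. p \<omega> * mat_adjoint (p \<omega>)) * ?F \<in> carrier_mat n n"
    "G * expect_mat M l l (\<lambda>\<omega>. q \<omega> * mat_adjoint (q \<omega>)) * ?G \<in> carrier_mat n n"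
    using F G c by (auto intro!: mult_carrier_mat)
  ultimately show "expect_mat M n n (\<lambda>\<omega>. (F * p \<omega> + G * q \<omega>) * mat_adjoint (F * p \<omega> + G * q \<omega>)) =
        F * expect_mat M k k (\<lambda>\<omega>. p \<omega> * mat_adjoint (p \<omega>)) * ?F +
        G * expect_mat M l l (\<lambda>\<omega>. q \<omega> * mat_adjoint (q \<omega>)) * ?G"
    unfolding expand
    using F G c
    by (simp add: expect_mat_add mat_integrable_add S1 S2 S3 S4 expect_mat_adjoint[OF pq] uncorrelated
        right_mult_zero_mat[of _ n] left_mult_zero_mat[of _ _ n] left_add_zero_mat[of _ n n]
        right_add_zero_mat[of _ n n])
qed

text \<open>As I - R G = s R, the error equals s R p - R q. Its covariance is s^2 R R + s R G R = s
  (s R + R G) R, and the bracket is the identity again. The lemma is applied once to each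
  equalizer.\<close>

lemma linear_equalizer_error_covariance:
  fixes p q :: "'w \<Rightarrow> complex mat" and s :: real
  assumes p: "\<And>\<omega>. p \<omega> \<in> carrier_mat n r" and q: "\<And>\<omega>. q \<omega> \<in> carrier_mat n r"
    and G: "G \<in> carrier_mat n n" and R: "R \<in> carrier_mat n n"
    and inv: "R * (G + complex_of_real s \<cdot>\<^sub>m 1\<^sub>m n) = 1\<^sub>m n" and herm: "mat_adjoint R = R"
    and pp: "mat_integrable M n n (\<lambda>\<omega>. p \<omega> * mat_adjoint (p \<omega>))"
    and pq: "mat_integrable M n n (\<lambda>\<omega>. p \<omega> * mat_adjoint (q \<omega>))"
    and qq: "mat_integrable M n n (\<lambda>\<omega>. q \<omega> * mat_adjoint (q \<omega>))"
    and Epp: "expect_mat M n n (\<lambda>\<omega>. p \<omega> * mat_adjoint (p \<omega>)) = 1\<^sub>m n"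
    and Epq: "expect_mat M n n (\<lambda>\<omega>. p \<omega> * mat_adjoint (q \<omega>)) = 0\<^sub>m n n"
    and Eqq: "expect_mat M n n (\<lambda>\<omega>. q \<omega> * mat_adjoint (q \<omega>)) = complex_of_real s \<cdot>\<^sub>m G"
  shows "expect_mat M n n (\<lambda>\<omega>. (p \<omega> - R * (G * p \<omega> + q \<omega>)) *
      mat_adjoint (p \<omega> - R * (G * p \<omega> + q \<omega>))) = complex_of_real s \<cdot>\<^sub>m R"
proof -
  define c where "c = complex_of_real s"
  have [simp]: "cnj c = c" by (simp add: c_def)
  note [simp] = G R mult_carrier_mat[of _ n n _ n] mult_carrier_mat[of _ n n _ r]
    left_mult_one_mat[of _ n n] right_mult_one_mat[of _ n n]
  have inv': "R * G + c \<cdot>\<^sub>m R = 1\<^sub>m n"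
    using inv by (simp add: mult_add_distrib_mat[of _ n n _ n] mult_smult_distrib[of _ n n _ n] c_def)
  have error: "p \<omega> - R * (G * p \<omega> + q \<omega>) = (c \<cdot>\<^sub>m R) * p \<omega> + ((- 1) \<cdot>\<^sub>m R) * q \<omega>" for \<omega>
  proof -
    note [simp] = p[of \<omega>] q[of \<omega>]
    have "p \<omega> = (R * G + c \<cdot>\<^sub>m R) * p \<omega>"
      unfolding inv' by (simp add: left_mult_one_mat[of _ n r])
    also have "\<dots> = R * (G * p \<omega>) + (c \<cdot>\<^sub>m R) * p \<omega>"
      by (simp add: add_mult_distrib_mat[of _ n n _ _ r] assoc_mult_mat[of _ n n _ n _ r])
    finally have "p \<omega> = R * (G * p \<omega>) + (c \<cdot>\<^sub>m R) * p \<omega>" .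
    then have "p \<omega> - R * (G * p \<omega> + q \<omega>) =
        (R * (G * p \<omega>) + (c \<cdot>\<^sub>m R) * p \<omega>) - (R * (G * p \<omega>) + R * q \<omega>)"
      by (simp add: mult_add_distrib_mat[of _ n n _ r])
    also have "\<dots> = (c \<cdot>\<^sub>m R) * p \<omega> - R * q \<omega>"
    proof -
      define U V W where "U = R * (G * p \<omega>)" and "V = (c \<cdot>\<^sub>m R) * p \<omega>" and "W = R * q \<omega>"
      have "U \<in> carrier_mat n r" "V \<in> carrier_mat n r" "W \<in> carrier_mat n r"
        by (simp_all add: U_def V_def W_def)
      then have "(U + V) - (U + W) = V - W"
        by (intro eq_matI) auto
      then show ?thesis unfolding U_def V_def W_def .
    qed
    also have "\<dots> = (c \<cdot>\<^sub>m R) * p \<omega> + ((- 1) \<cdot>\<^sub>m R) * q \<omega>"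
      by (simp add: mult_smult_assoc_mat[of _ n n _ r]) (intro eq_matI, auto simp: p q)
    finally show ?thesis .
  qed
  have adj: "mat_adjoint (c \<cdot>\<^sub>m R) = c \<cdot>\<^sub>m R" "mat_adjoint ((- 1) \<cdot>\<^sub>m R) = (- 1) \<cdot>\<^sub>m R"
    using herm by (simp_all add: mat_adjoint_smult)
  have "expect_mat M n n (\<lambda>\<omega>. (p \<omega> - R * (G * p \<omega> + q \<omega>)) *
      mat_adjoint (p \<omega> - R * (G * p \<omega> + q \<omega>))) =
      (c \<cdot>\<^sub>m R) * 1\<^sub>m n * (c \<cdot>\<^sub>m R) + ((- 1) \<cdot>\<^sub>m R) * (c \<cdot>\<^sub>m G) * ((- 1) \<cdot>\<^sub>m R)"
    unfolding error
    by (subst covariance_linear[OF p q _ _ pp pq qq Epq]) (simp_all add: Epp Eqq adj c_def[symmetric])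
  also have "((- 1) \<cdot>\<^sub>m R) * (c \<cdot>\<^sub>m G) * ((- 1) \<cdot>\<^sub>m R) = c \<cdot>\<^sub>m (R * G * R)"
    by (simp add: mult_smult_distrib[of _ n n _ n] mult_smult_assoc_mat[of _ n n _ n])
      (intro eq_matI, auto)
  also have "(c \<cdot>\<^sub>m R) * 1\<^sub>m n * (c \<cdot>\<^sub>m R) = c \<cdot>\<^sub>m ((c \<cdot>\<^sub>m R) * R)"
    by (simp add: mult_smult_distrib[of _ n n _ n] mult_smult_assoc_mat[of _ n n _ n])
  also have "c \<cdot>\<^sub>m ((c \<cdot>\<^sub>m R) * R) + c \<cdot>\<^sub>m (R * G * R) = c \<cdot>\<^sub>m ((R * G + c \<cdot>\<^sub>m R) * R)"
    by (simp add: add_mult_distrib_mat[of _ n n _ _ n] add_smult_distrib_left_mat[of _ n n]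
        comm_add_mat[of "R * G * R" n n])
  also have "\<dots> = c \<cdot>\<^sub>m R"
    unfolding inv' by simp
  finally show ?thesis unfolding c_def .
qed

section \<open>Moments of the noise and of the symbols\<close>

lemma (in prob_space) real_gaussian_square_integrable:
  assumes "real_gaussian M X"
  shows "integrable M (\<lambda>\<omega>. (X \<omega>)\<^sup>2)"
proof -
  have X [measurable]: "X \<in> borel_measurable M"
    using assms by (simp add: real_gaussian_def)
  consider \<mu> s where "s > 0" "distributed M lborel X (normal_density \<mu> s)" | \<mu> where "AE \<omega> in M. X \<omega> = \<mu>"
    using assms by (auto simp: real_gaussian_def)
  then show ?thesis
  proof cases
    case (1 \<mu> s)
    \<comment> \<open>The expansion of x^2 about the mean reduces the claim to central moments; the
      exponent 1 gives the middle term the shape of \<open>integrable_normal_moment\<close>.\<close>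
    have "integrable lborel (\<lambda>x. normal_density \<mu> s x * (x - \<mu>)^2 + 2 * \<mu> * (normal_density \<mu> s x * (x - \<mu>)^1)
        + \<mu>\<^sup>2 * normal_density \<mu> s x)"
      by (intro Bochner_Integration.integrable_add integrable_mult_right
          integrable_normal_moment[OF 1(1)] integrable_normal_density[OF 1(1)])
    also have "(\<lambda>x. normal_density \<mu> s x * (x - \<mu>)^2 + 2 * \<mu> * (normal_density \<mu> s x * (x - \<mu>)^1)
        + \<mu>\<^sup>2 * normal_density \<mu> s x) = (\<lambda>x. normal_density \<mu> s x * x\<^sup>2)"
      by (simp add: fun_eq_iff power2_eq_square algebra_simps)
    finally show ?thesis
      by (subst distributed_integrable[OF 1(2), symmetric]) auto
  next
    case (2 \<mu>)
    then have "integrable M (\<lambda>\<omega>. (X \<omega>)\<^sup>2) \<longleftrightarrow> integrable M (\<lambda>\<omega>. \<mu>\<^sup>2)"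
      by (intro integrable_cong_AE) auto
    then show ?thesis by simp
  qed
qed

lemma (in prob_space) complex_gaussian_vector_square_integrable:
  assumes v: "complex_gaussian_vector M n v" and i: "i < n"
  shows "integrable M (\<lambda>\<omega>. (cmod (v i \<omega>))\<^sup>2)"
proof -
  \<comment> \<open>Unit coefficient vectors single out the real or the imaginary part of entry
    \<open>i\<close> from the jointly Gaussian linear combinations.\<close>
  let ?e = "\<lambda>j. if j = i then 1 else 0 :: real"
  have "real_gaussian M (\<lambda>\<omega>. \<Sum>j<n. p j * Re (v j \<omega>) + q j * Im (v j \<omega>))" for p q
    using v by (simp add: complex_gaussian_vector_def)
  from this[of ?e "\<lambda>_. 0"] this[of "\<lambda>_. 0" ?e]
  have "real_gaussian M (\<lambda>\<omega>. Re (v i \<omega>))" "real_gaussian M (\<lambda>\<omega>. Im (v i \<omega>))"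
    using i by (simp_all add: if_distrib[of "\<lambda>x. x * _"] cong: if_cong)
  then show ?thesis
    by (simp add: cmod_power2 real_gaussian_square_integrable)
qed

text \<open>The product is dominated by |f|^2 + |g|^2, since 2 x y \<le> x^2 + y^2.\<close>

lemma integrable_mult_square_integrable:
  fixes f g :: "'w \<Rightarrow> complex"
  assumes [measurable]: "f \<in> borel_measurable M" "g \<in> borel_measurable M"
    and f: "integrable M (\<lambda>\<omega>. (cmod (f \<omega>))\<^sup>2)" and g: "integrable M (\<lambda>\<omega>. (cmod (g \<omega>))\<^sup>2)"
  shows "integrable M (\<lambda>\<omega>. f \<omega> * g \<omega>)"
proof (rule Bochner_Integration.integrable_bound)
  show "integrable M (\<lambda>\<omega>. (cmod (f \<omega>))\<^sup>2 + (cmod (g \<omega>))\<^sup>2)"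
    using f g by simp
  have "cmod (f \<omega> * g \<omega>) \<le> norm ((cmod (f \<omega>))\<^sup>2 + (cmod (g \<omega>))\<^sup>2)" for \<omega>
    using sum_squares_bound[of "cmod (f \<omega>)" "cmod (g \<omega>)"]
      mult_nonneg_nonneg[of "cmod (f \<omega>)" "cmod (g \<omega>)"]
    unfolding norm_mult real_norm_def by linarith
  then show "AE \<omega> in M. cmod (f \<omega> * g \<omega>) \<le> norm ((cmod (f \<omega>))\<^sup>2 + (cmod (g \<omega>))\<^sup>2)"
    by simp
qed measurable

section \<open>The symbol alphabet and its moments\<close>

lemma odd_interval_image: "{k \<in> {1..2 * m - 1}. odd k} = (\<lambda>i. 2 * i + 1) ` {..<m :: nat}"
proof (intro equalityI subsetI)
  fix k assume "k \<in> {k \<in> {1..2 * m - 1}. odd k}"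
  then show "k \<in> (\<lambda>i. 2 * i + 1) ` {..<m}" by (auto elim!: oddE)
qed auto

text \<open>Splitting by sign turns the odd multiples into two images of \<open>{..<m}\<close>, over
  which cardinality and sums are computed by reindexing.\<close>

lemma pam_alphabet_image:
  "pam_alphabet amp (2 * m) = (\<lambda>i. real (2 * i + 1) * amp) ` {..<m} \<union> (\<lambda>i. - (real (2 * i + 1) * amp)) ` {..<m}"
  (is "_ = ?P \<union> ?N")
proof (intro equalityI subsetI)
  fix s assume "s \<in> pam_alphabet amp (2 * m)"
  then obtain k where k: "s = real_of_int k * amp" "odd k" "\<bar>k\<bar> \<le> int (2 * m) - 1"
    by (auto simp: pam_alphabet_def)
  obtain l where l: "k = 2 * l + 1" using k(2) by (elim oddE)
  show "s \<in> ?P \<union> ?N"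
  proof (cases "0 \<le> l")
    case True
    then have "s = real (2 * nat l + 1) * amp" "nat l < m"
      using k l by auto
    then show ?thesis by blast
  next
    case False
    \<comment> \<open>For negative l the odd number 2 l + 1 is the negative of the positive odd
      number with index - l - 1.\<close>
    then have "s = - (real (2 * nat (- l - 1) + 1) * amp)" "nat (- l - 1) < m"
      using k l by (auto simp: algebra_simps of_nat_diff)
    then show ?thesis by blast
  qed
next
  fix s assume "s \<in> ?P \<union> ?N"
  then consider i where "i < m" "s = real_of_int (2 * int i + 1) * amp"
    | i where "i < m" "s = real_of_int (- (2 * int i + 1)) * amp"
    by (auto simp: algebra_simps)
  then show "s \<in> pam_alphabet amp (2 * m)"
  proof cases
    case 1
    then show ?thesis
      unfolding pam_alphabet_def by (intro CollectI exI[of _ "2 * int i + 1"]) auto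
  next
    case 2
    then show ?thesis
      unfolding pam_alphabet_def by (intro CollectI exI[of _ "- (2 * int i + 1)"]) auto
  qed
qed

text \<open>By symmetry about 0, opposite symbols cancel in the sum and contribute equal squares.
  \<open>amp > 0\<close> makes the halves disjoint and both parametrizations injective.\<close>

lemma pam_alphabet_sums:
  fixes amp :: real
  assumes amp: "amp > 0"
  shows "finite (pam_alphabet amp (2 * m))" "card (pam_alphabet amp (2 * m)) = 2 * m"
    "\<Sum>(pam_alphabet amp (2 * m)) = 0"
    "(\<Sum>s\<in>pam_alphabet amp (2 * m). s\<^sup>2) =
      2 * amp\<^sup>2 * (\<Sum>k | k \<in> {1..2 * m - 1} \<and> odd k. (real k)\<^sup>2)"
proof -
  let ?p = "\<lambda>i. real (2 * i + 1) * amp"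
  have pos: "?p i > 0" for i using amp by simp
  have inj: "inj_on ?p {..<m}" "inj_on (\<lambda>i. - ?p i) {..<m}"
    using amp by (auto intro!: inj_onI)
  have disj: "?p ` {..<m} \<inter> (\<lambda>i. - ?p i) ` {..<m} = {}"
    using pos by (auto simp: image_iff) (metis less_asym neg_less_0_iff_less)
  show "finite (pam_alphabet amp (2 * m))"
    by (simp add: pam_alphabet_image)
  show "card (pam_alphabet amp (2 * m)) = 2 * m"
    unfolding pam_alphabet_image
    by (subst card_Un_disjoint[OF _ _ disj]) (simp_all only: card_image[OF inj(1)] card_image[OF inj(2)], simp_all)
  have split: "sum f (pam_alphabet amp (2 * m)) = (\<Sum>i<m. f (?p i)) + (\<Sum>i<m. f (- ?p i))" for f :: "real \<Rightarrow> real"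
    unfolding pam_alphabet_image
    by (subst sum.union_disjoint[OF _ _ disj])
      (simp_all only: sum.reindex[OF inj(1)] sum.reindex[OF inj(2)] o_def, simp_all)
  show "\<Sum>(pam_alphabet amp (2 * m)) = 0"
    by (simp add: split sum_negf)
  have "(\<Sum>k | k \<in> {1..2 * m - 1} \<and> odd k. (real k)\<^sup>2) = (\<Sum>i<m. (real (2 * i + 1))\<^sup>2)"
    unfolding odd_interval_image by (subst sum.reindex) (auto intro: inj_onI)
  then show "(\<Sum>s\<in>pam_alphabet amp (2 * m). s\<^sup>2) =
      2 * amp\<^sup>2 * (\<Sum>k | k \<in> {1..2 * m - 1} \<and> odd k. (real k)\<^sup>2)"
    unfolding split by (simp add: power_mult_distrib sum_distrib_left sum_distrib_right mult_ac)
qed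

lemma (in prob_space) pam_symbol_moments:
  assumes X [measurable]: "X \<in> borel_measurable M"
    and unif: "distr M borel X = distr (measure_pmf (pmf_of_set (pam_alphabet amp N))) borel (\<lambda>s. s)"
    and amp: "amp > 0" and N: "even N" "N > 0"
    and energy: "2 * amp\<^sup>2 / real N * (\<Sum>k | k \<in> {1..N - 1} \<and> odd k. (real k)\<^sup>2) = 1"
  shows "integrable M X" "expectation X = 0"
    "integrable M (\<lambda>\<omega>. (X \<omega>)\<^sup>2)" "expectation (\<lambda>\<omega>. (X \<omega>)\<^sup>2) = 1"
proof -
  obtain m where m: "N = 2 * m" using N by (elim evenE)
  let ?S = "pam_alphabet amp N"
  note S = pam_alphabet_sums[OF amp, of m, folded m]
  have ne: "?S \<noteq> {}" using S(2) N by auto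
  \<comment> \<open>\<open>unif\<close> equates distributions only. Passing to the finite uniform
    distribution turns the expectation of any measurable \<open>f\<close> into an average over the
    alphabet and gives integrability.\<close>
  have moments: "integrable M (\<lambda>\<omega>. f (X \<omega>)) \<and> expectation (\<lambda>\<omega>. f (X \<omega>)) = sum f ?S / real N"
    if [measurable]: "f \<in> borel_measurable borel" for f :: "real \<Rightarrow> real"
  proof
    have "integrable (measure_pmf (pmf_of_set ?S)) f"
      using S(1) ne by (intro integrable_measure_pmf_finite) simp
    then have "integrable (distr M borel X) f"
      unfolding unif by (subst integrable_distr_eq) auto
    then show "integrable M (\<lambda>\<omega>. f (X \<omega>))"
      by (subst (asm) integrable_distr_eq) auto
    have "expectation (\<lambda>\<omega>. f (X \<omega>)) = integral\<^sup>L (distr M borel X) f"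
      by (subst integral_distr) auto
    also have "\<dots> = integral\<^sup>L (measure_pmf (pmf_of_set ?S)) f"
      unfolding unif by (subst integral_distr) auto
    also have "\<dots> = sum f ?S / real N"
      using integral_pmf_of_set[OF ne S(1)] S(2) by simp
    finally show "expectation (\<lambda>\<omega>. f (X \<omega>)) = sum f ?S / real N" .
  qed
  show "integrable M X" "expectation X = 0"
    using moments[of "\<lambda>x. x"] S(3) by simp_all
  \<comment> \<open>The energy normalization, multiplied by \<open>N\<close>, says that the squares
    of the \<open>N\<close> symbols sum to \<open>N\<close>.\<close>
  have "(\<Sum>s\<in>?S. s\<^sup>2) = real N"
    using energy N unfolding S(4) by (simp only: times_divide_eq_left) (simp only: divide_eq_1_iff)
  then show "integrable M (\<lambda>\<omega>. (X \<omega>)\<^sup>2)" "expectation (\<lambda>\<omega>. (X \<omega>)\<^sup>2) = 1"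
    using moments[of "\<lambda>x. x\<^sup>2"] N by simp_all
qed

section \<open>The real-only equalizer\<close>

(* keeps the simplifier from turning carrier_mat n 1 into carrier_mat n (Suc 0) *)
declare One_nat_def [simp del]

section \<open>Column vectors and their outer products\<close>

lemma col_vec_carrier [simp]: "col_vec n f \<in> carrier_mat n 1"
  by (simp add: col_vec_def)

lemma dim_col_vec [simp]: "dim_row (col_vec n f) = n" "dim_col (col_vec n f) = 1"
  by (simp_all add: col_vec_def)

lemma index_col_vec [simp]: "i < n \<Longrightarrow> col_vec n f $$ (i, 0) = f i"
  by (simp add: col_vec_def)

lemma index_col_vec_outer:
  "i < n \<Longrightarrow> j < k \<Longrightarrow> (col_vec n f * mat_adjoint (col_vec k g)) $$ (i, j) = f i * cnj (g j)"
  by (subst index_mult_mat_sum[of _ n 1 _ k]) simp_all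

lemma mat_integrable_outer:
  "mat_integrable M n k (\<lambda>\<omega>. col_vec n (\<lambda>i. f i \<omega>) * mat_adjoint (col_vec k (\<lambda>i. g i \<omega>))) \<longleftrightarrow>
    (\<forall>i<n. \<forall>j<k. integrable M (\<lambda>\<omega>. f i \<omega> * cnj (g j \<omega>)))"
  by (auto simp: mat_integrable_def index_col_vec_outer simp del: index_mult_mat
      intro!: mult_carrier_mat[of _ n 1])

lemma expect_mat_outer:
  "expect_mat M n k (\<lambda>\<omega>. col_vec n (\<lambda>i. f i \<omega>) * mat_adjoint (col_vec k (\<lambda>i. g i \<omega>))) =
    Matrix.mat n k (\<lambda>(i, j). \<integral>\<omega>. f i \<omega> * cnj (g j \<omega>) \<partial>M)"
  by (intro eq_matI) (simp_all add: index_col_vec_outer carrier_matD[OF expect_mat_carrier] del: index_mult_mat)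

lemma mat_cnj_col_vec: "mat_cnj (col_vec n f) = col_vec n (\<lambda>i. cnj (f i))"
  by (intro eq_matI) (auto simp: col_vec_def)

text \<open>Lets the pseudo-covariance E[v v^T] be read as the cross-covariance of v with its
  conjugate.\<close>

lemma transpose_col_vec: "transpose_mat (col_vec n f) = mat_adjoint (col_vec n (\<lambda>i. cnj (f i)))"
  by (intro eq_matI) (auto simp: col_vec_def)

lemma mat_cnj_hermitian:
  assumes "mat_adjoint X = X"
  shows "mat_cnj X = transpose_mat X"
proof -
  have "mat_cnj X = transpose_mat (mat_adjoint X)"
    by (intro eq_matI) auto
  then show ?thesis using assms by simp
qed

section \<open>The OQAM vector and the real-only observation\<close>

lemma a_vec_eq: "a_vec \<nu> a \<omega> = (2 \<cdot>\<^sub>m A_mat \<nu>) * x_vec \<nu> a \<omega>"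
  unfolding a_vec_def x_vec_def
  by (subst mult_smult_assoc_mat[of _ "2 * \<nu>" "2 * \<nu>" _ 1])
    (auto simp: A_mat_def mat_diag_mult_left[OF col_vec_carrier] oqam_def intro!: eq_matI)

text \<open>Even entries of x are real and odd entries purely imaginary. Through this identity a
  conjugated observation becomes a linear observation of the same x.\<close>

lemma mat_cnj_x_vec: "mat_cnj (x_vec \<nu> a \<omega>) = B_mat \<nu> * x_vec \<nu> a \<omega>"
  unfolding x_vec_def
  by (auto simp: B_mat_def mat_diag_mult_left[OF col_vec_carrier] oqam_def intro!: eq_matI)

lemma x_vec_carrier [simp]: "x_vec \<nu> a \<omega> \<in> carrier_mat (2 * \<nu>) 1"
  and v_vec_carrier [simp]: "v_vec \<nu> v \<omega> \<in> carrier_mat (2 * \<nu>) 1"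
  and a_vec_carrier [simp]: "a_vec \<nu> a \<omega> \<in> carrier_mat (2 * \<nu>) 1"
  by (simp_all add: x_vec_def v_vec_def a_vec_def)

text \<open>Hermitian symmetry turns the conjugate of Gamma into its transpose, so conj (Gamma x) =
  Gamma^T B x. The noise is split into its parts from v and from conj v, the two uncorrelated inputs
  of the covariance computation.\<close>

lemma y_a_vec_eq:
  assumes herm: "mat_adjoint (Gamma_mat \<nu> L h) = Gamma_mat \<nu> L h"
  shows "y_a_vec \<nu> L h a v \<omega> = Gamma_a_mat \<nu> L h * a_vec \<nu> a \<omega> +
    (A_mat \<nu> * v_vec \<nu> v \<omega> + (A_mat \<nu> * B_mat \<nu>) * mat_cnj (v_vec \<nu> v \<omega>))"
proof -
  let ?n = "2 * \<nu>"
  define A B G x w where "A = A_mat \<nu>" and "B = B_mat \<nu>" and "G = Gamma_mat \<nu> L h"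
    and "x = x_vec \<nu> a \<omega>" and "w = v_vec \<nu> v \<omega>"
  define Gt A' w' where "Gt = transpose_mat G" and "A' = mat_adjoint A" and "w' = mat_cnj w"
  have [simp]: "A \<in> carrier_mat ?n ?n" "B \<in> carrier_mat ?n ?n" "G \<in> carrier_mat ?n ?n"
    "x \<in> carrier_mat ?n 1" "w \<in> carrier_mat ?n 1"
    by (simp_all add: A_def B_def G_def x_def w_def)
  then have [simp]: "Gt \<in> carrier_mat ?n ?n" "A' \<in> carrier_mat ?n ?n" "w' \<in> carrier_mat ?n 1"
    by (simp_all add: Gt_def A'_def w'_def)
  note [simp] = mult_carrier_mat[of _ ?n ?n _ ?n] mult_carrier_mat[of _ ?n ?n _ 1]
  have "mat_cnj (y_vec \<nu> L h a v \<omega>) = mat_cnj (G * x) + w'"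
    unfolding y_vec_def G_def[symmetric] x_def[symmetric] w_def[symmetric] w'_def
    by (intro eq_matI) (auto simp: carrier_matD[of w ?n 1] carrier_matD[of G ?n ?n]
        carrier_matD[of x ?n 1] simp del: index_mult_mat(1))
  also have "mat_cnj (G * x) = mat_cnj G * mat_cnj x"
    by (intro eq_matI) (auto simp: scalar_prod_def carrier_matD[of G ?n ?n] carrier_matD[of x ?n 1])
  also have "\<dots> = Gt * (B * x)"
    using mat_cnj_hermitian[OF herm] mat_cnj_x_vec[of \<nu> a \<omega>] by (simp add: Gt_def G_def B_def x_def)
  finally have cnj_y: "mat_cnj (y_vec \<nu> L h a v \<omega>) = Gt * (B * x) + w'" .
  define U V where "U = G * x" and "V = B * (Gt * (B * x))"
  have UV [simp]: "U \<in> carrier_mat ?n 1" "V \<in> carrier_mat ?n 1"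
    by (simp_all add: U_def V_def)
  have "y_a_vec \<nu> L h a v \<omega> = A * ((U + w) + (V + B * w'))"
    unfolding y_a_vec_def cnj_y U_def V_def
    by (simp add: y_vec_def A_def[symmetric] B_def[symmetric] G_def[symmetric] x_def[symmetric]
        w_def[symmetric] mult_add_distrib_mat[of _ ?n ?n _ 1])
  also have "(U + w) + (V + B * w') = (U + V) + (w + B * w')"
    by (intro eq_matI) (auto simp: carrier_matD[of w ?n 1] carrier_matD[of w' ?n 1]
        carrier_matD[OF UV(1)] carrier_matD[OF UV(2)] carrier_matD[of B ?n ?n] simp del: index_mult_mat(1))
  also have "A * \<dots> = A * (U + V) + (A * w + (A * B) * w')"
    by (simp add: mult_add_distrib_mat[of _ ?n ?n _ 1] assoc_mult_mat[of _ ?n ?n _ ?n _ 1])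
  also have "A * (U + V) = Gamma_a_mat \<nu> L h * a_vec \<nu> a \<omega>"
  proof -
    define K where "K = G + B * Gt * B"
    have [simp]: "K \<in> carrier_mat ?n ?n" by (simp add: K_def)
    have "U + V = K * x"
      by (simp add: U_def V_def K_def add_mult_distrib_mat[of _ ?n ?n _ _ 1] assoc_mult_mat[of _ ?n ?n _ ?n _ 1])
    moreover have "Gamma_a_mat \<nu> L h * a_vec \<nu> a \<omega> = A * (K * x)"
    proof -
      have "Gamma_a_mat \<nu> L h * a_vec \<nu> a \<omega> = (2 \<cdot>\<^sub>m (A * K * A')) * ((2 \<cdot>\<^sub>m A) * x)"
        by (simp add: Gamma_a_mat_def a_vec_eq A_def B_def G_def x_def K_def Gt_def A'_def)
      \<comment> \<open>The 4 collects the factor 2 in Gamma_a and the factor 2 in a = 2 A x; it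
        cancels against A^H A = I/4.\<close>
      also have "\<dots> = 4 \<cdot>\<^sub>m (A * K * (A' * A) * x)"
        by (simp add: mult_smult_assoc_mat[of _ ?n ?n _ 1] mult_smult_distrib[of _ ?n ?n _ 1]
            assoc_mult_mat[of _ ?n ?n _ ?n _ 1] assoc_mult_mat[of _ ?n ?n _ ?n _ ?n])
          (intro eq_matI, auto)
      also have "A' * A = (1 / 4) \<cdot>\<^sub>m 1\<^sub>m ?n"
        unfolding A'_def A_def by (rule A_mat_adjoint)
      also have "4 \<cdot>\<^sub>m (A * K * ((1 / 4) \<cdot>\<^sub>m 1\<^sub>m ?n) * x) = A * K * x"
        by (simp add: mult_smult_distrib[of _ ?n ?n _ ?n] mult_smult_assoc_mat[of _ ?n ?n _ 1]
            right_mult_one_mat[of _ ?n ?n]) (intro eq_matI, auto)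
      finally show ?thesis
        by (simp add: assoc_mult_mat[of _ ?n ?n _ ?n _ 1])
    qed
    ultimately show ?thesis by simp
  qed
  finally show ?thesis
    by (simp add: A_def B_def w_def w'_def)
qed

text \<open>With the unitary U = 2 A, \<open>X\<close> is half of U Y U^H, so its inverse is 2 U
  Y^-1 U^H = 8 A Y^-1 A^H. Unitary conjugation preserves the trace, which leaves the factor
  2.\<close>

lemma minv_scaled_congruence:
  assumes A: "A \<in> carrier_mat n n" and AA: "A * mat_adjoint A = (1 / 4) \<cdot>\<^sub>m 1\<^sub>m n"
    "mat_adjoint A * A = (1 / 4) \<cdot>\<^sub>m 1\<^sub>m n" and Y: "pos_def n Y"
  defines "X \<equiv> 2 \<cdot>\<^sub>m (A * Y * mat_adjoint A)" and "R \<equiv> 8 \<cdot>\<^sub>m (A * minv Y * mat_adjoint A)"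
  shows "R * X = 1\<^sub>m n" "minv X = R" "mat_adjoint R = R" "mat_tr R = 2 * mat_tr (minv Y)"
proof -
  define A' where "A' = mat_adjoint A"
  define S where "S = minv Y"
  note inv = pos_def_minv[OF Y, folded S_def]
  have [simp]: "A \<in> carrier_mat n n" "A' \<in> carrier_mat n n" "S \<in> carrier_mat n n" "Y \<in> carrier_mat n n"
    using A Y inv by (simp_all add: A'_def)
  note [simp] = mult_carrier_mat[of _ n n _ n] left_mult_one_mat[of _ n n] right_mult_one_mat[of _ n n]
  note smult = mult_smult_assoc_mat[of _ n n _ n] mult_smult_distrib[of _ n n _ n]
  note AA' = AA[folded A'_def]
  \<comment> \<open>Covers both orders of multiplication. The product 16 of the scalars 2 and 8 is
    compensated by a factor 1/4 from A^H A in the middle and another from A A^H outside.\<close>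
  have *: "(c \<cdot>\<^sub>m (A * P * A')) * (d \<cdot>\<^sub>m (A * Q * A')) = 1\<^sub>m n"
    if "P * Q = 1\<^sub>m n" and PQ [simp]: "P \<in> carrier_mat n n" "Q \<in> carrier_mat n n" and "c * d = 16" for P Q c d
  proof -
    have "(c \<cdot>\<^sub>m (A * P * A')) * (d \<cdot>\<^sub>m (A * Q * A')) = (c * d) \<cdot>\<^sub>m (A * P * (A' * A) * Q * A')"
      by (simp add: smult assoc_mult_mat[of _ n n _ n _ n]) (intro eq_matI, auto)
    also have "A * P * (A' * A) * Q * A' = (1 / 4) \<cdot>\<^sub>m (A * (P * Q) * A')"
      unfolding AA' by (simp add: smult assoc_mult_mat[of _ n n _ n _ n])
    also have "\<dots> = (1 / 16) \<cdot>\<^sub>m 1\<^sub>m n"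
      unfolding that(1) by (simp add: AA') (intro eq_matI, auto)
    finally show ?thesis
      using \<open>c * d = 16\<close> by simp (intro eq_matI, auto)
  qed
  have c: "X \<in> carrier_mat n n" "R \<in> carrier_mat n n"
    unfolding X_def R_def A'_def[symmetric] S_def[symmetric] by simp_all
  show RX: "R * X = 1\<^sub>m n"
    unfolding X_def R_def A'_def[symmetric] S_def[symmetric] by (rule *) (simp_all add: inv)
  have "X * R = 1\<^sub>m n"
    unfolding X_def R_def A'_def[symmetric] S_def[symmetric] by (rule *) (simp_all add: inv)
  then show "minv X = R"
    by (intro minv_eqI[OF c _ RX])
  have "mat_adjoint (A * S * A') = A * S * A'"
    using pos_def_hermitian[OF inv(4)]
    by (simp add: mat_adjoint_mult[of _ n n _ n] A'_def assoc_mult_mat[of _ n n _ n _ n] A)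
  then show "mat_adjoint R = R"
    by (simp add: R_def mat_adjoint_smult A'_def S_def)
  have "mat_tr R = 8 * mat_tr (A * (S * A'))"
    unfolding R_def A'_def[symmetric] S_def[symmetric]
    by (simp add: mat_tr_smult[of _ n] assoc_mult_mat[of _ n n _ n _ n])
  also have "mat_tr (A * (S * A')) = mat_tr ((S * A') * A)"
    by (rule mat_tr_mult_comm[of _ n n]) simp_all
  also have "(S * A') * A = (1 / 4) \<cdot>\<^sub>m S"
    by (simp add: assoc_mult_mat[of _ n n _ n _ n] AA' smult)
  finally show "mat_tr R = 2 * mat_tr (minv Y)"
    by (simp add: mat_tr_smult[of _ n] S_def[symmetric])
qed

text \<open>Each x(n) is a(n) times a fixed phase \<open>u n\<close> of modulus 1. Distinct
  positions are uncorrelated by independence and zero mean, and on the diagonal the phase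
  cancels.\<close>

lemma (in prob_space) oqam_second_moments:
  assumes indep: "indep_vars (\<lambda>_. borel) a {..<2 * \<nu>}"
    and a: "\<And>n. n < 2 * \<nu> \<Longrightarrow> integrable M (a n)" "\<And>n. n < 2 * \<nu> \<Longrightarrow> expectation (a n) = 0"
    and a2: "\<And>n. n < 2 * \<nu> \<Longrightarrow> integrable M (\<lambda>\<omega>. (a n \<omega>)\<^sup>2)"
      "\<And>n. n < 2 * \<nu> \<Longrightarrow> expectation (\<lambda>\<omega>. (a n \<omega>)\<^sup>2) = 1"
  shows "mat_integrable M (2 * \<nu>) (2 * \<nu>) (\<lambda>\<omega>. x_vec \<nu> a \<omega> * mat_adjoint (x_vec \<nu> a \<omega>))"
    and "expect_mat M (2 * \<nu>) (2 * \<nu>) (\<lambda>\<omega>. x_vec \<nu> a \<omega> * mat_adjoint (x_vec \<nu> a \<omega>)) = 1\<^sub>m (2 * \<nu>)"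
proof -
  define u :: "nat \<Rightarrow> complex" where "u n = (if even n then 1 else \<i>)" for n
  have prod: "oqam a m \<omega> * cnj (oqam a n \<omega>) = u m * cnj (u n) * complex_of_real (a m \<omega> * a n \<omega>)" for m n \<omega>
    by (simp add: oqam_def u_def)
  have moments: "integrable M (\<lambda>\<omega>. a m \<omega> * a n \<omega>)"
      "expectation (\<lambda>\<omega>. a m \<omega> * a n \<omega>) = (if m = n then 1 else 0)"
    if mn: "m < 2 * \<nu>" "n < 2 * \<nu>" for m n
  proof -
    have "integrable M (\<lambda>\<omega>. a m \<omega> * a n \<omega>) \<and>
      expectation (\<lambda>\<omega>. a m \<omega> * a n \<omega>) = (if m = n then 1 else 0)"
    proof (cases "m = n")
      case True
      then show ?thesis using a2 mn by (simp add: power2_eq_square)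
    next
      case False
      have "indep_vars (\<lambda>_. borel) a {m, n}"
        using mn by (intro indep_vars_subset[OF indep]) auto
      from indep_vars_integrable[OF _ this] indep_vars_lebesgue_integral[OF _ this]
      show ?thesis using False a mn by auto
    qed
    then show "integrable M (\<lambda>\<omega>. a m \<omega> * a n \<omega>)"
      "expectation (\<lambda>\<omega>. a m \<omega> * a n \<omega>) = (if m = n then 1 else 0)" by simp_all
  qed
  show "mat_integrable M (2 * \<nu>) (2 * \<nu>) (\<lambda>\<omega>. x_vec \<nu> a \<omega> * mat_adjoint (x_vec \<nu> a \<omega>))"
    unfolding x_vec_def mat_integrable_outer prod using moments(1)
    by (auto intro!: integrable_mult_right integrable_of_real simp del: of_real_mult)
  show "expect_mat M (2 * \<nu>) (2 * \<nu>) (\<lambda>\<omega>. x_vec \<nu> a \<omega> * mat_adjoint (x_vec \<nu> a \<omega>)) = 1\<^sub>m (2 * \<nu>)"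
    unfolding x_vec_def expect_mat_outer prod
    by (intro eq_matI) (auto simp: moments u_def simp del: of_real_mult)
qed

text \<open>Independence of the vectors passes to their entries by coordinate projections, and to
  conjugated entries of \<open>g\<close> by composing with a further measurable map
  \<open>c\<close>. The expectation of each product then factors, and the mean of \<open>g\<close>
  is zero.\<close>

lemma (in prob_space) uncorrelated_outer:
  assumes indep: "indep_var (cvec_algebra n) (\<lambda>\<omega>. \<lambda>i\<in>{..<n}. g i \<omega>) (cvec_algebra n) (\<lambda>\<omega>. \<lambda>i\<in>{..<n}. f i \<omega>)"
    and f: "\<And>i. i < n \<Longrightarrow> integrable M (f i)"
    and g: "\<And>i. i < n \<Longrightarrow> integrable M (g i)" "\<And>i. i < n \<Longrightarrow> expectation (g i) = 0"
  shows "mat_integrable M n n (\<lambda>\<omega>. col_vec n (\<lambda>i. f i \<omega>) * mat_adjoint (col_vec n (\<lambda>i. g i \<omega>)))"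
    and "mat_integrable M n n (\<lambda>\<omega>. col_vec n (\<lambda>i. f i \<omega>) * mat_adjoint (col_vec n (\<lambda>i. cnj (g i \<omega>))))"
    and "expect_mat M n n (\<lambda>\<omega>. col_vec n (\<lambda>i. f i \<omega>) * mat_adjoint (col_vec n (\<lambda>i. g i \<omega>))) = 0\<^sub>m n n"
    and "expect_mat M n n (\<lambda>\<omega>. col_vec n (\<lambda>i. f i \<omega>) * mat_adjoint (col_vec n (\<lambda>i. cnj (g i \<omega>)))) = 0\<^sub>m n n"
proof -
  have fg: "indep_var borel (\<lambda>\<omega>. c (g j \<omega>)) borel (f i)"
    if ij: "i < n" "j < n" and [measurable]: "c \<in> borel_measurable borel" for i j and c :: "complex \<Rightarrow> complex"
  proof -
    have "indep_var borel ((\<lambda>x. c (x j)) \<circ> (\<lambda>\<omega>. \<lambda>i\<in>{..<n}. g i \<omega>)) borel ((\<lambda>x. x i) \<circ> (\<lambda>\<omega>. \<lambda>i\<in>{..<n}. f i \<omega>))"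
      using ij by (intro indep_var_compose[OF indep] measurable_compose[OF _ that(3)]
          measurable_component_singleton) auto
    then show ?thesis using ij by (simp add: o_def)
  qed
  have conj: "integrable M (\<lambda>\<omega>. f i \<omega> * cnj (g j \<omega>))" "expectation (\<lambda>\<omega>. f i \<omega> * cnj (g j \<omega>)) = 0"
    if ij: "i < n" "j < n" for i j
  proof -
    have g': "integrable M (\<lambda>\<omega>. cnj (g j \<omega>))" "expectation (\<lambda>\<omega>. cnj (g j \<omega>)) = 0"
      using g ij by simp_all
    have "indep_var borel (\<lambda>\<omega>. cnj (g j \<omega>)) borel (f i)"
      by (rule fg[OF ij]) (intro borel_measurable_continuous_onI continuous_intros)
    from indep_var_integrable[OF this g'(1) f] indep_var_lebesgue_integral[OF this g'(1) f] ij g'(2)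
    show "integrable M (\<lambda>\<omega>. f i \<omega> * cnj (g j \<omega>))" "expectation (\<lambda>\<omega>. f i \<omega> * cnj (g j \<omega>)) = 0"
      by (simp_all add: mult.commute)
  qed
  have plain: "integrable M (\<lambda>\<omega>. f i \<omega> * g j \<omega>)" "expectation (\<lambda>\<omega>. f i \<omega> * g j \<omega>) = 0"
    if ij: "i < n" "j < n" for i j
  proof -
    have "indep_var borel (g j) borel (f i)"
      using fg[OF ij, of "\<lambda>x. x"] by simp
    from indep_var_integrable[OF this g(1) f] indep_var_lebesgue_integral[OF this g(1) f] ij g(2)
    show "integrable M (\<lambda>\<omega>. f i \<omega> * g j \<omega>)" "expectation (\<lambda>\<omega>. f i \<omega> * g j \<omega>) = 0"
      by (simp_all add: mult.commute)
  qed
  show "mat_integrable M n n (\<lambda>\<omega>. col_vec n (\<lambda>i. f i \<omega>) * mat_adjoint (col_vec n (\<lambda>i. g i \<omega>)))"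
    "mat_integrable M n n (\<lambda>\<omega>. col_vec n (\<lambda>i. f i \<omega>) * mat_adjoint (col_vec n (\<lambda>i. cnj (g i \<omega>))))"
    unfolding mat_integrable_outer using conj plain by simp_all
  show "expect_mat M n n (\<lambda>\<omega>. col_vec n (\<lambda>i. f i \<omega>) * mat_adjoint (col_vec n (\<lambda>i. g i \<omega>))) = 0\<^sub>m n n"
    "expect_mat M n n (\<lambda>\<omega>. col_vec n (\<lambda>i. f i \<omega>) * mat_adjoint (col_vec n (\<lambda>i. cnj (g i \<omega>)))) = 0\<^sub>m n n"
    unfolding expect_mat_outer by (intro eq_matI; simp add: conj plain)+
qed

text \<open>On a probability space square integrability suffices: the product criterion is applied
  with the constant factor 1.\<close>

lemma (in prob_space) complex_gaussian_vector_integrable: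
  assumes v: "complex_gaussian_vector M n v" and i: "i < n"
  shows "integrable M (v i)"
proof -
  have "v i \<in> borel_measurable M"
    using v i by (simp add: complex_gaussian_vector_def)
  from integrable_mult_square_integrable[OF this _ complex_gaussian_vector_square_integrable[OF v i], of "\<lambda>_. 1"]
  show ?thesis by simp
qed

lemma (in prob_space) complex_gaussian_vector_outer_integrable:
  assumes v: "complex_gaussian_vector M n v"
  shows "mat_integrable M n n (\<lambda>\<omega>. col_vec n (\<lambda>i. v i \<omega>) * mat_adjoint (col_vec n (\<lambda>i. v i \<omega>)))"
    and "mat_integrable M n n (\<lambda>\<omega>. col_vec n (\<lambda>i. v i \<omega>) * mat_adjoint (col_vec n (\<lambda>i. cnj (v i \<omega>))))"
    and "mat_integrable M n n (\<lambda>\<omega>. col_vec n (\<lambda>i. cnj (v i \<omega>)) * mat_adjoint (col_vec n (\<lambda>i. cnj (v i \<omega>))))"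
proof -
  have [measurable]: "i < n \<Longrightarrow> v i \<in> borel_measurable M" for i
    using v by (simp add: complex_gaussian_vector_def)
  have [measurable]: "i < n \<Longrightarrow> (\<lambda>\<omega>. cnj (v i \<omega>)) \<in> borel_measurable M" for i
    by (intro measurable_compose[of "v i" _ borel cnj] borel_measurable_continuous_onI continuous_intros) simp
  show "mat_integrable M n n (\<lambda>\<omega>. col_vec n (\<lambda>i. v i \<omega>) * mat_adjoint (col_vec n (\<lambda>i. v i \<omega>)))"
    "mat_integrable M n n (\<lambda>\<omega>. col_vec n (\<lambda>i. v i \<omega>) * mat_adjoint (col_vec n (\<lambda>i. cnj (v i \<omega>))))"
    "mat_integrable M n n (\<lambda>\<omega>. col_vec n (\<lambda>i. cnj (v i \<omega>)) * mat_adjoint (col_vec n (\<lambda>i. cnj (v i \<omega>))))"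
    unfolding mat_integrable_outer
    by (auto intro!: integrable_mult_square_integrable complex_gaussian_vector_square_integrable[OF v])
qed

section \<open>Comparison of the two equalizers\<close>

theorem claim2:
  fixes M :: "'w measure"
    and \<nu> L N :: nat
    and amp N0 \<sigma>2 :: real
    and h :: "int \<Rightarrow> complex"
    and a :: "nat \<Rightarrow> 'w \<Rightarrow> real"
    and v :: "nat \<Rightarrow> 'w \<Rightarrow> complex"
  assumes prob: "prob_space M"
    and nu: "\<nu> \<ge> 1"
    and amp: "amp > 0"
    and N: "\<exists>p\<ge>1. N = 2 ^ p"
    and energy: "2 * amp\<^sup>2 / real N * (\<Sum>k | k \<in> {1..N - 1} \<and> odd k. (real k)\<^sup>2) = 1"
    and a_indep: "prob_space.indep_vars M (\<lambda>_. borel) a {..<2 * \<nu>}"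
    and a_unif: "\<And>n. n < 2 * \<nu> \<Longrightarrow>
      distr M borel (a n) = distr (measure_pmf (pmf_of_set (pam_alphabet amp N))) borel (\<lambda>s. s)"
    and h_supp: "\<And>k. k < 0 \<or> k > int L \<Longrightarrow> h k = 0"
    and h_nz: "\<exists>k. h k \<noteq> 0"
    and N0: "N0 \<ge> 0"
    and sigma2: "\<sigma>2 = 2 * N0"
    and v_gauss: "complex_gaussian_vector M (2 * \<nu>) v"
    and v_circ: "circularly_symmetric M (2 * \<nu>) v"
    and v_mean: "expect_mat M (2 * \<nu>) 1 (v_vec \<nu> v) = 0\<^sub>m (2 * \<nu>) 1"
    and v_cov: "expect_mat M (2 * \<nu>) (2 * \<nu>) (\<lambda>\<omega>. v_vec \<nu> v \<omega> * mat_adjoint (v_vec \<nu> v \<omega>))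
      = complex_of_real \<sigma>2 \<cdot>\<^sub>m Gamma_mat \<nu> L h"
    and v_pcov: "expect_mat M (2 * \<nu>) (2 * \<nu>) (\<lambda>\<omega>. v_vec \<nu> v \<omega> * transpose_mat (v_vec \<nu> v \<omega>))
      = 0\<^sub>m (2 * \<nu>) (2 * \<nu>)"
    and v_x_indep: "prob_space.indep_var M
      (cvec_algebra (2 * \<nu>)) (\<lambda>\<omega>. \<lambda>n\<in>{..<2 * \<nu>}. v n \<omega>)
      (cvec_algebra (2 * \<nu>)) (\<lambda>\<omega>. \<lambda>n\<in>{..<2 * \<nu>}. oqam a n \<omega>)"
  shows "MMSE_ROE M \<nu> L h \<sigma>2 a v \<le> MMSE_LE M \<nu> L h \<sigma>2 a v"
proof -
  interpret prob_space M by (rule prob)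
  let ?n = "2 * \<nu>"
  define A B G where "A = A_mat \<nu>" and "B = B_mat \<nu>" and "G = Gamma_mat \<nu> L h"
  define s where "s = complex_of_real \<sigma>2"
  define x w where "x = x_vec \<nu> a" and "w = v_vec \<nu> v"
  define w' where "w' \<omega> = mat_cnj (w \<omega>)" for \<omega>
  have w_def': "w \<omega> = col_vec ?n (\<lambda>n. v n \<omega>)" and w'_def': "w' \<omega> = col_vec ?n (\<lambda>n. cnj (v n \<omega>))"
    and x_def': "x \<omega> = col_vec ?n (\<lambda>n. oqam a n \<omega>)" for \<omega>
    by (simp_all add: w_def w'_def v_vec_def x_def x_vec_def mat_cnj_col_vec)
  have [simp]: "A \<in> carrier_mat ?n ?n" "B \<in> carrier_mat ?n ?n" "G \<in> carrier_mat ?n ?n"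
    "x \<omega> \<in> carrier_mat ?n 1" "w \<omega> \<in> carrier_mat ?n 1" "w' \<omega> \<in> carrier_mat ?n 1" for \<omega>
    by (simp_all add: A_def B_def G_def x_def w_def w'_def)
  note [simp] = mult_carrier_mat[of _ ?n ?n _ ?n] mult_carrier_mat[of _ ?n ?n _ 1]
  have "0 \<le> \<sigma>2" using N0 sigma2 by simp

  have G: "pos_def ?n G"
    unfolding G_def by (rule Gamma_mat_pos_def[OF h_supp h_nz])
  define P Q where "P = G + s \<cdot>\<^sub>m 1\<^sub>m ?n" and "Q = B * transpose_mat G * B"
  have P: "pos_def ?n P"
    unfolding P_def s_def by (rule pos_def_add_scalar[OF G \<open>0 \<le> \<sigma>2\<close>])
  \<comment> \<open>\<open>B\<close> is Hermitian and its own inverse, so it serves both as the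
    congruence and as its left inverse.\<close>
  have Q: "pos_def ?n Q"
    using pos_def_congruence[OF pos_def_transpose[OF G], of B B] by (simp add: Q_def B_def B_mat_square)
  have Y: "pos_def ?n (P + Q)"
    by (rule pos_def_add[OF P Q])

  have a_meas: "a n \<in> borel_measurable M" if "n < ?n" for n
    using a_indep that by (simp add: indep_vars_def)
  obtain p where "p \<ge> 1" "N = 2 ^ p" using N by blast
  then have "even N" "N > 0" by simp_all
  note a_moments = pam_symbol_moments[OF a_meas a_unif amp this energy]
  have xx: "mat_integrable M ?n ?n (\<lambda>\<omega>. x \<omega> * mat_adjoint (x \<omega>))"
      "expect_mat M ?n ?n (\<lambda>\<omega>. x \<omega> * mat_adjoint (x \<omega>)) = 1\<^sub>m ?n"
    unfolding x_def by (rule oqam_second_moments[OF a_indep a_moments]; assumption)+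
  have v_int: "integrable M (v n)" "expectation (v n) = 0" if "n < ?n" for n
    using complex_gaussian_vector_integrable[OF v_gauss that]
      arg_cong[OF v_mean, of "\<lambda>X. X $$ (n, 0)"] that by (simp_all add: v_vec_def)
  have x_int: "integrable M (oqam a n)" if "n < ?n" for n
    using a_moments(1)[OF that that] unfolding oqam_def[abs_def]
    by (cases "even n") (simp_all add: integrable_of_real)
  have xw: "mat_integrable M ?n ?n (\<lambda>\<omega>. x \<omega> * mat_adjoint (w \<omega>))"
      "mat_integrable M ?n ?n (\<lambda>\<omega>. x \<omega> * mat_adjoint (w' \<omega>))"
      "expect_mat M ?n ?n (\<lambda>\<omega>. x \<omega> * mat_adjoint (w \<omega>)) = 0\<^sub>m ?n ?n"
      "expect_mat M ?n ?n (\<lambda>\<omega>. x \<omega> * mat_adjoint (w' \<omega>)) = 0\<^sub>m ?n ?n"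
    unfolding x_def' w_def' w'_def'
    by (rule uncorrelated_outer[OF v_x_indep x_int v_int]; assumption)+
  note ww = complex_gaussian_vector_outer_integrable[OF v_gauss, folded w_def' w'_def']
  have Eww: "expect_mat M ?n ?n (\<lambda>\<omega>. w \<omega> * mat_adjoint (w \<omega>)) = s \<cdot>\<^sub>m G"
    using v_cov by (simp add: w_def G_def s_def)
  \<comment> \<open>The vanishing pseudo-covariance, read as uncorrelatedness of the noise and its
    conjugate.\<close>
  have Eww': "expect_mat M ?n ?n (\<lambda>\<omega>. w \<omega> * mat_adjoint (w' \<omega>)) = 0\<^sub>m ?n ?n"
    using v_pcov by (simp add: v_vec_def transpose_col_vec w_def' w'_def')
  \<comment> \<open>Conjugating the noise swaps the two indices of its covariance.\<close>
  have Ew'w': "expect_mat M ?n ?n (\<lambda>\<omega>. w' \<omega> * mat_adjoint (w' \<omega>)) = s \<cdot>\<^sub>m transpose_mat G"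
  proof (rule eq_matI)
    fix i j assume "i < dim_row (s \<cdot>\<^sub>m transpose_mat G)" "j < dim_col (s \<cdot>\<^sub>m transpose_mat G)"
    then have ij: "i < ?n" "j < ?n" by (simp_all add: carrier_matD[of G ?n ?n])
    have "(\<integral>\<omega>. cnj (v i \<omega>) * v j \<omega> \<partial>M) = (\<integral>\<omega>. v j \<omega> * cnj (v i \<omega>) \<partial>M)"
      by (simp add: mult.commute)
    also have "\<dots> = (s \<cdot>\<^sub>m G) $$ (j, i)"
      unfolding Eww[symmetric] w_def' expect_mat_outer using ij by simp
    finally show "expect_mat M ?n ?n (\<lambda>\<omega>. w' \<omega> * mat_adjoint (w' \<omega>)) $$ (i, j) = (s \<cdot>\<^sub>m transpose_mat G) $$ (i, j)"
      unfolding w'_def' expect_mat_outer using ij by (simp add: carrier_matD[of G ?n ?n])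
  qed (simp_all add: carrier_matD[OF expect_mat_carrier] carrier_matD[of G ?n ?n])

  have LE: "MMSE_LE M \<nu> L h \<sigma>2 a v = \<sigma>2 / real ?n * Re (mat_tr (minv P))"
  proof -
    have "expect_mat M ?n ?n (\<lambda>\<omega>. (x \<omega> - minv P * (G * x \<omega> + w \<omega>)) *
        mat_adjoint (x \<omega> - minv P * (G * x \<omega> + w \<omega>))) = s \<cdot>\<^sub>m minv P"
      unfolding s_def
    proof (rule linear_equalizer_error_covariance[where r = 1])
      show "minv P * (G + complex_of_real \<sigma>2 \<cdot>\<^sub>m 1\<^sub>m ?n) = 1\<^sub>m ?n"
        using minv_left[OF P] by (simp add: P_def s_def)
      show "mat_adjoint (minv P) = minv P"
        by (rule pos_def_hermitian[OF minv_pos_def[OF P]])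
    qed (use xx xw ww Eww P in \<open>simp_all add: s_def\<close>)
    moreover have "minv P \<in> carrier_mat ?n ?n" using P by simp
    ultimately show ?thesis
      by (simp add: MMSE_LE_def avg_mse_def x_hat_LE_def y_vec_def x_def w_def G_def P_def s_def mat_tr_smult[of _ ?n])
  qed

  define Ga R where "Ga = Gamma_a_mat \<nu> L h" and "R = minv (Ga + complex_of_real (\<sigma>2 / 2) \<cdot>\<^sub>m 1\<^sub>m ?n)"
  define wa where "wa \<omega> = A * w \<omega> + (A * B) * w' \<omega>" for \<omega>
  have [simp]: "Ga \<in> carrier_mat ?n ?n" "wa \<omega> \<in> carrier_mat ?n 1" for \<omega>
    by (simp_all add: wa_def Ga_def Gamma_a_mat_def)
  have Ga_shift: "Ga + complex_of_real (\<sigma>2 / 2) \<cdot>\<^sub>m 1\<^sub>m ?n = 2 \<cdot>\<^sub>m (A * (P + Q) * mat_adjoint A)"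
    using Gamma_a_mat_add_scalar[of \<nu> L h s] by (simp add: Ga_def A_def B_def G_def P_def Q_def s_def)
  note congruence = minv_scaled_congruence[OF A_mat_carrier[of \<nu>] A_mat_adjoint[of \<nu>] Y, folded A_def]
  have R_eq: "R = 8 \<cdot>\<^sub>m (A * minv (P + Q) * mat_adjoint A)"
    unfolding R_def Ga_shift by (rule congruence(2))
  have A_adj [simp]: "mat_adjoint A \<in> carrier_mat ?n ?n"
    by simp
  \<comment> \<open>The two noise parts contribute s A G A^H and s A Q A^H, and Gamma_a is twice A
    (G + Q) A^H. The covariance is thus again a noise level, now \<open>\<sigma>2 / 2\<close>, times
    the system matrix, as the error formula requires.\<close>
  have Ewawa: "expect_mat M ?n ?n (\<lambda>\<omega>. wa \<omega> * mat_adjoint (wa \<omega>)) = complex_of_real (\<sigma>2 / 2) \<cdot>\<^sub>m Ga"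
  proof -
    have "expect_mat M ?n ?n (\<lambda>\<omega>. wa \<omega> * mat_adjoint (wa \<omega>)) =
        A * (s \<cdot>\<^sub>m G) * mat_adjoint A + A * B * (s \<cdot>\<^sub>m transpose_mat G) * mat_adjoint (A * B)"
      unfolding wa_def
      by (subst covariance_linear[where k = ?n and l = ?n and r = 1]) (simp_all add: ww Eww Eww' Ew'w')
    also have "mat_adjoint (A * B) = B * mat_adjoint A"
      by (subst mat_adjoint_mult[of _ ?n ?n _ ?n]) (simp_all add: B_def)
    also have "A * (s \<cdot>\<^sub>m G) * mat_adjoint A + A * B * (s \<cdot>\<^sub>m transpose_mat G) * (B * mat_adjoint A)
        = s \<cdot>\<^sub>m (A * (G + Q) * mat_adjoint A)"
      by (simp add: Q_def mult_smult_distrib[of _ ?n ?n _ ?n] mult_smult_assoc_mat[of _ ?n ?n _ ?n]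
          mult_add_distrib_mat[of _ ?n ?n _ ?n] add_mult_distrib_mat[of _ ?n ?n _ _ ?n]
          assoc_mult_mat[of _ ?n ?n _ ?n _ ?n] add_smult_distrib_left_mat[of _ ?n ?n])
    also have "\<dots> = complex_of_real (\<sigma>2 / 2) \<cdot>\<^sub>m Ga"
      by (simp add: Ga_def Gamma_a_mat_def A_def B_def G_def Q_def s_def) (intro eq_matI, auto)
    finally show ?thesis .
  qed
  have x_wa: "x \<omega> * mat_adjoint (wa \<omega>) =
      x \<omega> * mat_adjoint (w \<omega>) * mat_adjoint A + x \<omega> * mat_adjoint (w' \<omega>) * mat_adjoint (A * B)" for \<omega>
  proof -
    have "mat_adjoint (wa \<omega>) = mat_adjoint (w \<omega>) * mat_adjoint A + mat_adjoint (w' \<omega>) * mat_adjoint (A * B)"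
      unfolding wa_def
      by (simp add: mat_adjoint_add[of _ ?n 1] mat_adjoint_mult[of _ ?n ?n "w \<omega>" 1]
          mat_adjoint_mult[of _ ?n ?n "w' \<omega>" 1])
    then show ?thesis
      by (simp add: mult_add_distrib_mat[of _ ?n 1 _ ?n] assoc_mult_mat[of _ ?n 1 _ ?n _ ?n]
          mult_carrier_mat[of _ 1 ?n _ ?n])
  qed
  have AB_adj: "mat_adjoint (A * B) \<in> carrier_mat ?n ?n"
    by simp
  note xwa_int = mat_integrable_add[OF mat_integrable_mult_right[OF xw(1) A_adj]
      mat_integrable_mult_right[OF xw(2) AB_adj]]
  have Exwa: "expect_mat M ?n ?n (\<lambda>\<omega>. x \<omega> * mat_adjoint (wa \<omega>)) = 0\<^sub>m ?n ?n"
    unfolding x_wa expect_mat_add[OF mat_integrable_mult_right[OF xw(1) A_adj]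
        mat_integrable_mult_right[OF xw(2) AB_adj]]
      expect_mat_mult_right[OF xw(1) A_adj] expect_mat_mult_right[OF xw(2) AB_adj] xw(3,4)
    using A_adj AB_adj by (simp add: left_mult_zero_mat[of _ ?n ?n])
  \<comment> \<open>\<open>D\<close> is unitary and maps x to the real symbols, so their identity
    covariance and their uncorrelatedness with the noise are inherited from x.\<close>
  define D where "D = 2 \<cdot>\<^sub>m A"
  have [simp]: "D \<in> carrier_mat ?n ?n" and D_adj [simp]: "mat_adjoint D \<in> carrier_mat ?n ?n"
    by (simp_all add: D_def)
  define y where "y \<omega> = D * x \<omega>" for \<omega>
  have y: "a_vec \<nu> a \<omega> = y \<omega>" for \<omega>
    by (simp add: y_def D_def A_def x_def a_vec_eq)
  have [simp]: "y \<omega> \<in> carrier_mat ?n 1" for \<omega> by (simp add: y_def)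
  have yy: "y \<omega> * mat_adjoint (y \<omega>) = D * (x \<omega> * mat_adjoint (x \<omega>)) * mat_adjoint D"
    and y_wa: "y \<omega> * mat_adjoint (wa \<omega>) = D * (x \<omega> * mat_adjoint (wa \<omega>))" for \<omega>
    by (simp_all add: y_def mat_adjoint_mult[of _ ?n ?n _ 1] assoc_mult_mat[of _ ?n ?n _ 1 _ ?n]
        assoc_mult_mat[of _ ?n ?n _ ?n _ ?n] assoc_mult_mat[of _ ?n 1 _ ?n _ ?n]
        mult_carrier_mat[of _ ?n 1 _ ?n] mult_carrier_mat[of _ 1 ?n _ ?n])
  have DD: "D * mat_adjoint D = 1\<^sub>m ?n"
    using A_mat_adjoint(1)[of \<nu>, folded A_def]
    by (simp add: D_def mat_adjoint_smult mult_smult_distrib[of _ ?n ?n _ ?n]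
        mult_smult_assoc_mat[of _ ?n ?n _ ?n]) (intro eq_matI, auto)
  have yy_int: "mat_integrable M ?n ?n (\<lambda>\<omega>. y \<omega> * mat_adjoint (y \<omega>))"
    unfolding yy by (intro mat_integrable_mult_right[OF mat_integrable_mult_left[OF xx(1)]]) simp_all
  have Eyy: "expect_mat M ?n ?n (\<lambda>\<omega>. y \<omega> * mat_adjoint (y \<omega>)) = 1\<^sub>m ?n"
    unfolding yy
    by (subst expect_mat_mult_right[OF mat_integrable_mult_left[OF xx(1)]])
      (simp_all add: expect_mat_mult_left[OF xx(1)] xx(2) right_mult_one_mat[of _ ?n ?n] DD)
  have y_wa_int: "mat_integrable M ?n ?n (\<lambda>\<omega>. y \<omega> * mat_adjoint (wa \<omega>))"
    unfolding y_wa by (rule mat_integrable_mult_left[where n = ?n]) (simp_all add: x_wa xwa_int)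
  have Eywa: "expect_mat M ?n ?n (\<lambda>\<omega>. y \<omega> * mat_adjoint (wa \<omega>)) = 0\<^sub>m ?n ?n"
    unfolding y_wa
    by (subst expect_mat_mult_left[where n = ?n])
      (simp_all add: Exwa xwa_int[folded x_wa] right_mult_zero_mat[of _ ?n ?n])
  have ROE: "MMSE_ROE M \<nu> L h \<sigma>2 a v = \<sigma>2 / real ?n * Re (mat_tr (minv (P + Q)))"
  proof -
    have wawa: "mat_integrable M ?n ?n (\<lambda>\<omega>. wa \<omega> * mat_adjoint (wa \<omega>))"
      unfolding wa_def
      by (rule mat_integrable_covariance_linear[where k = ?n and l = ?n and r = 1]) (simp_all add: ww Eww')
    have R: "R \<in> carrier_mat ?n ?n"
      unfolding R_eq using Y by simp
    have "expect_mat M ?n ?n (\<lambda>\<omega>. (y \<omega> - R * (Ga * y \<omega> + wa \<omega>)) *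
        mat_adjoint (y \<omega> - R * (Ga * y \<omega> + wa \<omega>))) = complex_of_real (\<sigma>2 / 2) \<cdot>\<^sub>m R"
    proof (rule linear_equalizer_error_covariance[where r = 1])
      show "R * (Ga + complex_of_real (\<sigma>2 / 2) \<cdot>\<^sub>m 1\<^sub>m ?n) = 1\<^sub>m ?n" "mat_adjoint R = R"
        unfolding R_eq Ga_shift by (rule congruence(1,3))+
    qed (use R yy_int Eyy y_wa_int Eywa wawa Ewawa in simp_all)
    moreover have "y_a_vec \<nu> L h a v \<omega> = Ga * y \<omega> + wa \<omega>" for \<omega>
      using y_a_vec_eq[of \<nu> L h a v \<omega>] pos_def_hermitian[OF G]
      by (simp add: G_def Ga_def y wa_def A_def B_def w_def w'_def)
    \<comment> \<open>This 2 cancels the one in \<open>\<sigma>2 / 2\<close>, so both error figures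
      carry the same prefactor and only the traces remain to be compared.\<close>
    moreover have "mat_tr R = 2 * mat_tr (minv (P + Q))"
      unfolding R_eq by (rule congruence(4))
    ultimately show ?thesis
      using R by (simp add: MMSE_ROE_def avg_mse_def a_hat_ROE_def y Ga_def[symmetric] R_def[symmetric]
          mat_tr_smult[of _ ?n] del: of_real_divide)
  qed
  show ?thesis
    unfolding LE ROE using trace_minv_antimono[OF P Q] \<open>0 \<le> \<sigma>2\<close>
    by (intro mult_left_mono) auto
qed

end
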